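(* For every prime number $p$, one has $w_3(\mathbb{Q}_p)=2$, and $$w_3(\mathbb{Z}_p)=\begin{cases}4 & \text{if } p=3,\\ 3 & \text{if } p=7,\\ 2 & \text{if } p\equiv 1\pmod 3 \text{ and } p\neq 7,\\ 2 & \text{if } p\equiv 2\pmod 3.\end{cases}$$
   Context: For a commutative ring $A$ and a positive integer $n$, the $n$th Waring number $w_n(A)$ is the smallest positive integer $g$ such that every element of $A$ that is a sum of (finitely many) $n$th powers is a sum of at most $g$ $n$th powers ($\infty$ if none). $\mathbb{Z}_p$ is the ring of $p$-adic integers and $\mathbb{Q}_p$ its field of fractions. *)

theory Defs
  imports "HOL-Number_Theory.Residues" "HOL-Library.Extended_Nat"
begin

section \<open>Waring numbers\<close>

definition sum_of_powers :: "('a, 'b) ring_scheme \<Rightarrow> nat \<Rightarrow> nat \<Rightarrow> 'a \<Rightarrow> bool" where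
  "sum_of_powers R n k x \<longleftrightarrow>
     (\<exists>f \<in> {..<k} \<rightarrow> carrier R. x = (\<Oplus>\<^bsub>R\<^esub>i\<in>{..<k}. f i [^]\<^bsub>R\<^esub> n))"

(* In enat the infimum of a nonempty set is its least element, and Inf {} = \<infinity>. *)
definition waring_number :: "('a, 'b) ring_scheme \<Rightarrow> nat \<Rightarrow> enat" where
  "waring_number R n = Inf {enat g | g. g > 0 \<and>
     (\<forall>x \<in> carrier R. (\<exists>k. sum_of_powers R n k x) \<longrightarrow> (\<exists>k\<le>g. sum_of_powers R n k x))}"


section \<open>The field of fractions of an integral domain\<close>

definition fraction_rel :: "('a, 'b) ring_scheme \<Rightarrow> (('a \<times> 'a) \<times> ('a \<times> 'a)) set" where
  "fraction_rel R = {((a, b), (c, d)).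
     a \<in> carrier R \<and> b \<in> carrier R - {\<zero>\<^bsub>R\<^esub>} \<and> c \<in> carrier R \<and> d \<in> carrier R - {\<zero>\<^bsub>R\<^esub>} \<and>
     a \<otimes>\<^bsub>R\<^esub> d = c \<otimes>\<^bsub>R\<^esub> b}"

definition fraction_class :: "('a, 'b) ring_scheme \<Rightarrow> 'a \<Rightarrow> 'a \<Rightarrow> ('a \<times> 'a) set" where
  "fraction_class R a b = fraction_rel R `` {(a, b)}"

definition fraction_field :: "('a, 'b) ring_scheme \<Rightarrow> ('a \<times> 'a) set ring" where
  "fraction_field R =
     \<lparr>carrier = (carrier R \<times> (carrier R - {\<zero>\<^bsub>R\<^esub>})) // fraction_rel R,
      monoid.mult = \<lambda>X Y. \<Union>(a, b)\<in>X. \<Union>(c, d)\<in>Y. fraction_class R (a \<otimes>\<^bsub>R\<^esub> c) (b \<otimes>\<^bsub>R\<^esub> d),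
      one = fraction_class R \<one>\<^bsub>R\<^esub> \<one>\<^bsub>R\<^esub>,
      zero = fraction_class R \<zero>\<^bsub>R\<^esub> \<one>\<^bsub>R\<^esub>,
      add = \<lambda>X Y. \<Union>(a, b)\<in>X. \<Union>(c, d)\<in>Y.
        fraction_class R (a \<otimes>\<^bsub>R\<^esub> d \<oplus>\<^bsub>R\<^esub> c \<otimes>\<^bsub>R\<^esub> b) (b \<otimes>\<^bsub>R\<^esub> d)\<rparr>"

context "domain"
begin

lemma equiv_fraction_rel: "equiv (carrier R \<times> (carrier R - {\<zero>})) (fraction_rel R)"
proof (rule equivI)
  show "fraction_rel R \<subseteq> (carrier R \<times> (carrier R - {\<zero>})) \<times> (carrier R \<times> (carrier R - {\<zero>}))"
    by (auto simp: fraction_rel_def)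
  show "refl_on (carrier R \<times> (carrier R - {\<zero>})) (fraction_rel R)"
    by (auto simp: refl_on_def fraction_rel_def)
  show "sym (fraction_rel R)"
    by (auto simp: sym_def fraction_rel_def)
  show "trans (fraction_rel R)"
  proof (rule transI, clarify)
    fix a b c d e f
    assume 1: "((a, b), (c, d)) \<in> fraction_rel R" and 2: "((c, d), (e, f)) \<in> fraction_rel R"
    from 1 2 have C: "a \<in> carrier R" "b \<in> carrier R" "c \<in> carrier R" "d \<in> carrier R"
        "e \<in> carrier R" "f \<in> carrier R" "b \<noteq> \<zero>" "d \<noteq> \<zero>" "f \<noteq> \<zero>"
      and E: "a \<otimes> d = c \<otimes> b" "c \<otimes> f = e \<otimes> d"
      by (auto simp: fraction_rel_def)
    have "d \<otimes> (a \<otimes> f) = (a \<otimes> d) \<otimes> f" using C by (simp add: m_ac)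
    also have "\<dots> = (c \<otimes> f) \<otimes> b" using C E by (simp add: m_ac)
    also have "\<dots> = d \<otimes> (e \<otimes> b)" using C E by (simp add: m_ac)
    finally have "a \<otimes> f = e \<otimes> b" using C by (simp add: m_lcancel)
    then show "((a, b), (e, f)) \<in> fraction_rel R" using C by (simp add: fraction_rel_def)
  qed
qed

lemma fraction_class_eq_iff:
  assumes "a \<in> carrier R" "b \<in> carrier R" "b \<noteq> \<zero>" "c \<in> carrier R" "d \<in> carrier R" "d \<noteq> \<zero>"
  shows "fraction_class R a b = fraction_class R c d \<longleftrightarrow> a \<otimes> d = c \<otimes> b"
  using eq_equiv_class_iff[OF equiv_fraction_rel, of "(a, b)" "(c, d)"] assms
  by (auto simp: fraction_class_def fraction_rel_def)

lemma fraction_class_closed: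
  assumes "a \<in> carrier R" "b \<in> carrier R" "b \<noteq> \<zero>"
  shows "fraction_class R a b \<in> carrier (fraction_field R)"
  using assms by (auto simp: fraction_field_def fraction_class_def intro!: quotientI)

lemma fraction_fieldE:
  assumes "X \<in> carrier (fraction_field R)"
  obtains a b where "a \<in> carrier R" "b \<in> carrier R" "b \<noteq> \<zero>" "X = fraction_class R a b"
  using assms by (auto simp: fraction_field_def fraction_class_def elim!: quotientE)

lemma fraction_class_mult:
  assumes "a \<in> carrier R" "b \<in> carrier R" "b \<noteq> \<zero>" "c \<in> carrier R" "d \<in> carrier R" "d \<noteq> \<zero>"
  shows "fraction_class R a b \<otimes>\<^bsub>fraction_field R\<^esub> fraction_class R c d =
         fraction_class R (a \<otimes> c) (b \<otimes> d)"
proof -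
  have *: "fraction_class R (a' \<otimes> c') (b' \<otimes> d') = fraction_class R (a \<otimes> c) (b \<otimes> d)"
    if "((a, b), (a', b')) \<in> fraction_rel R" "((c, d), (c', d')) \<in> fraction_rel R" for a' b' c' d'
  proof -
    from that have C: "a' \<in> carrier R" "b' \<in> carrier R" "b' \<noteq> \<zero>"
        "c' \<in> carrier R" "d' \<in> carrier R" "d' \<noteq> \<zero>"
      and E: "a \<otimes> b' = a' \<otimes> b" "c \<otimes> d' = c' \<otimes> d"
      by (auto simp: fraction_rel_def)
    have "(a' \<otimes> c') \<otimes> (b \<otimes> d) = (a' \<otimes> b) \<otimes> (c' \<otimes> d)" using assms C by (simp add: m_ac)
    also have "\<dots> = (a \<otimes> b') \<otimes> (c \<otimes> d')" using E by simp
    also have "\<dots> = (a \<otimes> c) \<otimes> (b' \<otimes> d')" using assms C by (simp add: m_ac)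
    finally show ?thesis
      using assms C by (subst fraction_class_eq_iff) (auto simp: integral_iff)
  qed
  have "(a, b) \<in> fraction_class R a b" "(c, d) \<in> fraction_class R c d"
    using assms by (auto simp: fraction_class_def fraction_rel_def)
  then have "(\<Union>(a', b')\<in>fraction_class R a b. \<Union>(c', d')\<in>fraction_class R c d.
      fraction_class R (a' \<otimes> c') (b' \<otimes> d')) = fraction_class R (a \<otimes> c) (b \<otimes> d)"
    using * unfolding fraction_class_def[of R a b] fraction_class_def[of R c d] by blast
  then show ?thesis by (simp add: fraction_field_def)
qed

lemma fraction_class_add:
  assumes "a \<in> carrier R" "b \<in> carrier R" "b \<noteq> \<zero>" "c \<in> carrier R" "d \<in> carrier R" "d \<noteq> \<zero>"
  shows "fraction_class R a b \<oplus>\<^bsub>fraction_field R\<^esub> fraction_class R c d =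
         fraction_class R (a \<otimes> d \<oplus> c \<otimes> b) (b \<otimes> d)"
proof -
  have *: "fraction_class R (a' \<otimes> d' \<oplus> c' \<otimes> b') (b' \<otimes> d') =
           fraction_class R (a \<otimes> d \<oplus> c \<otimes> b) (b \<otimes> d)"
    if "((a, b), (a', b')) \<in> fraction_rel R" "((c, d), (c', d')) \<in> fraction_rel R" for a' b' c' d'
  proof -
    from that have C: "a' \<in> carrier R" "b' \<in> carrier R" "b' \<noteq> \<zero>"
        "c' \<in> carrier R" "d' \<in> carrier R" "d' \<noteq> \<zero>"
      and E: "a \<otimes> b' = a' \<otimes> b" "c \<otimes> d' = c' \<otimes> d"
      by (auto simp: fraction_rel_def)
    have "(a' \<otimes> d' \<oplus> c' \<otimes> b') \<otimes> (b \<otimes> d) =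
          (a' \<otimes> b) \<otimes> (d \<otimes> d') \<oplus> (c' \<otimes> d) \<otimes> (b \<otimes> b')"
      using assms C by (simp add: l_distr r_distr m_ac)
    also have "\<dots> = (a \<otimes> b') \<otimes> (d \<otimes> d') \<oplus> (c \<otimes> d') \<otimes> (b \<otimes> b')" using E by simp
    also have "\<dots> = (a \<otimes> d \<oplus> c \<otimes> b) \<otimes> (b' \<otimes> d')" using assms C by (simp add: l_distr r_distr m_ac)
    finally show ?thesis
      using assms C by (subst fraction_class_eq_iff) (auto simp: integral_iff)
  qed
  have "(a, b) \<in> fraction_class R a b" "(c, d) \<in> fraction_class R c d"
    using assms by (auto simp: fraction_class_def fraction_rel_def)
  then have "(\<Union>(a', b')\<in>fraction_class R a b. \<Union>(c', d')\<in>fraction_class R c d.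
      fraction_class R (a' \<otimes> d' \<oplus> c' \<otimes> b') (b' \<otimes> d')) =
      fraction_class R (a \<otimes> d \<oplus> c \<otimes> b) (b \<otimes> d)"
    using * unfolding fraction_class_def[of R a b] fraction_class_def[of R c d] by blast
  then show ?thesis by (simp add: fraction_field_def)
qed

lemma fraction_class_zero: "\<zero>\<^bsub>fraction_field R\<^esub> = fraction_class R \<zero> \<one>"
  by (simp add: fraction_field_def)

lemma fraction_class_one: "\<one>\<^bsub>fraction_field R\<^esub> = fraction_class R \<one> \<one>"
  by (simp add: fraction_field_def)

lemmas fraction_class_simps =
  fraction_class_mult fraction_class_add fraction_class_zero fraction_class_one
  fraction_class_eq_iff fraction_class_closed integral_iff

lemma field_fraction_field: "field (fraction_field R)"
proof -
  let ?K = "fraction_field R"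
  have "cring ?K"
  proof (rule cringI)
    show "abelian_group ?K"
    proof (rule abelian_groupI)
      fix X Y Z assume "X \<in> carrier ?K" "Y \<in> carrier ?K" "Z \<in> carrier ?K"
      then show "X \<oplus>\<^bsub>?K\<^esub> Y \<oplus>\<^bsub>?K\<^esub> Z = X \<oplus>\<^bsub>?K\<^esub> (Y \<oplus>\<^bsub>?K\<^esub> Z)"
        by (elim fraction_fieldE) (simp add: fraction_class_simps l_distr r_distr m_ac a_ac)
    next
      fix X Y assume "X \<in> carrier ?K" "Y \<in> carrier ?K"
      then show "X \<oplus>\<^bsub>?K\<^esub> Y = Y \<oplus>\<^bsub>?K\<^esub> X" "X \<oplus>\<^bsub>?K\<^esub> Y \<in> carrier ?K"
        by (elim fraction_fieldE; simp add: fraction_class_simps m_ac a_ac)+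
    next
      fix X assume "X \<in> carrier ?K"
      then show "\<zero>\<^bsub>?K\<^esub> \<oplus>\<^bsub>?K\<^esub> X = X"
        by (elim fraction_fieldE) (simp add: fraction_class_simps)
      from \<open>X \<in> carrier ?K\<close> obtain a b
        where ab: "a \<in> carrier R" "b \<in> carrier R" "b \<noteq> \<zero>" "X = fraction_class R a b"
        by (elim fraction_fieldE)
      then have "fraction_class R (\<ominus> a) b \<oplus>\<^bsub>?K\<^esub> X = \<zero>\<^bsub>?K\<^esub>"
        by (simp add: fraction_class_simps l_minus l_neg)
      with ab show "\<exists>Y\<in>carrier ?K. Y \<oplus>\<^bsub>?K\<^esub> X = \<zero>\<^bsub>?K\<^esub>"
        by (intro bexI[of _ "fraction_class R (\<ominus> a) b"]) (auto simp: fraction_class_closed)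
    qed (simp add: fraction_class_simps)
  next
    show "comm_monoid ?K"
    proof (rule comm_monoidI)
      fix X Y Z assume "X \<in> carrier ?K" "Y \<in> carrier ?K" "Z \<in> carrier ?K"
      then show "X \<otimes>\<^bsub>?K\<^esub> Y \<otimes>\<^bsub>?K\<^esub> Z = X \<otimes>\<^bsub>?K\<^esub> (Y \<otimes>\<^bsub>?K\<^esub> Z)"
        by (elim fraction_fieldE) (simp add: fraction_class_simps m_ac)
    next
      fix X Y assume "X \<in> carrier ?K" "Y \<in> carrier ?K"
      then show "X \<otimes>\<^bsub>?K\<^esub> Y = Y \<otimes>\<^bsub>?K\<^esub> X" "X \<otimes>\<^bsub>?K\<^esub> Y \<in> carrier ?K"
        by (elim fraction_fieldE; simp add: fraction_class_simps m_ac)+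
    next
      fix X assume "X \<in> carrier ?K"
      then show "\<one>\<^bsub>?K\<^esub> \<otimes>\<^bsub>?K\<^esub> X = X"
        by (elim fraction_fieldE) (simp add: fraction_class_simps)
    qed (simp add: fraction_class_simps)
  next
    fix X Y Z assume "X \<in> carrier ?K" "Y \<in> carrier ?K" "Z \<in> carrier ?K"
    then show "(X \<oplus>\<^bsub>?K\<^esub> Y) \<otimes>\<^bsub>?K\<^esub> Z = X \<otimes>\<^bsub>?K\<^esub> Z \<oplus>\<^bsub>?K\<^esub> Y \<otimes>\<^bsub>?K\<^esub> Z"
      by (elim fraction_fieldE) (simp add: fraction_class_simps l_distr r_distr m_ac a_ac)
  qed
  then show ?thesis
  proof (rule cring.cring_fieldI2)
    show "\<zero>\<^bsub>?K\<^esub> \<noteq> \<one>\<^bsub>?K\<^esub>"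
      by (simp add: fraction_class_simps)
  next
    fix X assume X: "X \<in> carrier ?K" "X \<noteq> \<zero>\<^bsub>?K\<^esub>"
    then obtain a b
      where ab: "a \<in> carrier R" "b \<in> carrier R" "b \<noteq> \<zero>" "X = fraction_class R a b"
      by (elim fraction_fieldE)
    with X have "a \<noteq> \<zero>" by (auto simp: fraction_class_simps)
    with ab have "X \<otimes>\<^bsub>?K\<^esub> fraction_class R b a = \<one>\<^bsub>?K\<^esub>"
      by (simp add: fraction_class_simps m_ac)
    with ab \<open>a \<noteq> \<zero>\<close> show "\<exists>Y\<in>carrier ?K. X \<otimes>\<^bsub>?K\<^esub> Y = \<one>\<^bsub>?K\<^esub>"
      by (intro bexI[of _ "fraction_class R b a"]) (auto simp: fraction_class_closed)
  qed
qed

end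


section \<open>The \<open>p\<close>-adic integers and the \<open>p\<close>-adic numbers\<close>

(* The inverse limit of the rings Z / p^(k+1) Z over k :: nat, with ring operations taken
   componentwise.  The trivial ring Z / p^0 Z is left out because residue_ring 1 does not
   have its unit in its carrier. *)
definition padic_integers :: "nat \<Rightarrow> (nat \<Rightarrow> int) ring" where
  "padic_integers p =
     \<lparr>carrier = {x. \<forall>k. x k \<in> carrier (residue_ring (int p ^ Suc k)) \<and>
                      x (Suc k) mod int p ^ Suc k = x k},
      monoid.mult = \<lambda>x y k. x k \<otimes>\<^bsub>residue_ring (int p ^ Suc k)\<^esub> y k,
      one = \<lambda>k. \<one>\<^bsub>residue_ring (int p ^ Suc k)\<^esub>,
      zero = \<lambda>k. \<zero>\<^bsub>residue_ring (int p ^ Suc k)\<^esub>,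
      add = \<lambda>x y k. x k \<oplus>\<^bsub>residue_ring (int p ^ Suc k)\<^esub> y k\<rparr>"

definition padic_numbers :: "nat \<Rightarrow> ((nat \<Rightarrow> int) \<times> (nat \<Rightarrow> int)) set ring" where
  "padic_numbers p = fraction_field (padic_integers p)"

lemma padic_integers_simps:
  "x \<in> carrier (padic_integers p) \<longleftrightarrow>
     (\<forall>k. 0 \<le> x k \<and> x k < int p ^ Suc k \<and> x (Suc k) mod int p ^ Suc k = x k)"
  "x \<otimes>\<^bsub>padic_integers p\<^esub> y = (\<lambda>k. x k * y k mod int p ^ Suc k)"
  "x \<oplus>\<^bsub>padic_integers p\<^esub> y = (\<lambda>k. (x k + y k) mod int p ^ Suc k)"
  "\<one>\<^bsub>padic_integers p\<^esub> = (\<lambda>k. 1)"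
  "\<zero>\<^bsub>padic_integers p\<^esub> = (\<lambda>k. 0)"
  by (auto simp: padic_integers_def residue_ring_def)

lemma padic_integers_closedI:
  fixes f :: "nat \<Rightarrow> int"
  assumes "p > 0" "\<And>k. [f (Suc k) = f k] (mod int p ^ Suc k)"
  shows "(\<lambda>k. f k mod int p ^ Suc k) \<in> carrier (padic_integers p)"
proof -
  have "f (Suc k) mod int p ^ Suc (Suc k) mod int p ^ Suc k = f k mod int p ^ Suc k" for k
    using assms(2)[of k] by (simp add: cong_def mod_mod_cancel)
  then show ?thesis using assms(1) by (simp add: padic_integers_simps)
qed

lemma padic_integers_cong:
  assumes "x \<in> carrier (padic_integers p)" "i \<le> k"
  shows "x k mod int p ^ Suc i = x i"
  using assms(2)
proof (induction k rule: dec_induct)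
  case base
  with assms(1) show ?case by (simp add: padic_integers_simps)
next
  case (step k)
  have "x (Suc k) mod int p ^ Suc i = x (Suc k) mod int p ^ Suc k mod int p ^ Suc i"
    using step by (subst mod_mod_cancel) (simp_all add: le_imp_power_dvd del: power_Suc)
  also have "\<dots> = x i"
    using assms(1) step by (simp add: padic_integers_simps del: power_Suc)
  finally show ?case .
qed

lemma cring_padic_integers:
  assumes "p > 1"
  shows "cring (padic_integers p)"
proof -
  let ?Z = "padic_integers p"
  have C: "[x (Suc k) = x k] (mod int p ^ Suc k)" if "x \<in> carrier ?Z" for x k
    using that by (auto simp: padic_integers_simps cong_def)
  have M: "x k mod int p ^ Suc k = x k" if "x \<in> carrier ?Z" for x k
    using that by (auto simp: padic_integers_simps simp del: power_Suc)
  have add: "x \<oplus>\<^bsub>?Z\<^esub> y \<in> carrier ?Z" and mult: "x \<otimes>\<^bsub>?Z\<^esub> y \<in> carrier ?Z"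
    if "x \<in> carrier ?Z" "y \<in> carrier ?Z" for x y
    using padic_integers_closedI[of p "\<lambda>k. x k + y k"] padic_integers_closedI[of p "\<lambda>k. x k * y k"]
      C that assms by (simp_all add: padic_integers_simps(2-) cong_add cong_mult)
  have p1: "1 < int p ^ Suc k" for k
    using assms one_less_power[of "int p" "Suc k"] by simp
  show ?thesis
  proof (rule cringI)
    show "abelian_group ?Z"
    proof (rule abelian_groupI)
      fix x assume x: "x \<in> carrier ?Z"
      have "(\<lambda>k. (- x k) mod int p ^ Suc k) \<in> carrier ?Z"
        using x C assms by (intro padic_integers_closedI) (auto simp: cong_minus_minus_iff)
      moreover have "(\<lambda>k. (- x k) mod int p ^ Suc k) \<oplus>\<^bsub>?Z\<^esub> x = \<zero>\<^bsub>?Z\<^esub>"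
        by (simp add: padic_integers_simps(2-) mod_add_left_eq del: power_Suc)
      ultimately show "\<exists>y\<in>carrier ?Z. y \<oplus>\<^bsub>?Z\<^esub> x = \<zero>\<^bsub>?Z\<^esub>" by blast
      show "\<zero>\<^bsub>?Z\<^esub> \<oplus>\<^bsub>?Z\<^esub> x = x"
        using M[OF x] by (simp add: padic_integers_simps(2-) del: power_Suc)
    next
      show "\<zero>\<^bsub>?Z\<^esub> \<in> carrier ?Z" using assms by (simp add: padic_integers_simps)
    qed (auto simp: add, auto simp: padic_integers_simps(2-) mod_simps add_ac simp del: power_Suc)
  next
    show "comm_monoid ?Z"
    proof (rule comm_monoidI)
      fix x assume x: "x \<in> carrier ?Z"
      show "\<one>\<^bsub>?Z\<^esub> \<otimes>\<^bsub>?Z\<^esub> x = x"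
        using M[OF x] by (simp add: padic_integers_simps(2-) del: power_Suc)
    next
      show "\<one>\<^bsub>?Z\<^esub> \<in> carrier ?Z" using p1 by (simp add: padic_integers_simps del: power_Suc)
    qed (auto simp: mult, auto simp: padic_integers_simps(2-) mod_simps mult_ac simp del: power_Suc)
  qed (auto simp: padic_integers_simps(2-) mod_simps algebra_simps simp del: power_Suc)
qed

lemma domain_padic_integers:
  assumes "prime p"
  shows "domain (padic_integers p)"
proof -
  let ?Z = "padic_integers p"
  from assms have "p > 1" by (rule prime_gt_1_nat)
  interpret cring ?Z by (rule cring_padic_integers) fact
  have nz: "\<exists>i. \<forall>k\<ge>i. x k \<noteq> 0 \<and> multiplicity (int p) (x k) \<le> i"
    if x: "x \<in> carrier ?Z" "x \<noteq> \<zero>\<^bsub>?Z\<^esub>" for x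
  proof -
    from x(2) obtain i where i: "x i \<noteq> 0" by (auto simp: padic_integers_simps(2-))
    have "\<not> int p ^ Suc i dvd x k" if "k \<ge> i" for k
      using padic_integers_cong[OF x(1) that] i by (auto simp del: power_Suc)
    then have "x k \<noteq> 0 \<and> multiplicity (int p) (x k) < Suc i" if "k \<ge> i" for k
      using that by (metis dvd_0_right multiplicity_dvd' not_less)
    then show ?thesis by (intro exI[of _ i]) (auto simp: less_Suc_eq_le)
  qed
  show ?thesis
  proof unfold_locales
    show "\<one>\<^bsub>?Z\<^esub> \<noteq> \<zero>\<^bsub>?Z\<^esub>" by (simp add: padic_integers_simps(2-) fun_eq_iff)
  next
    fix x y assume xy: "x \<otimes>\<^bsub>?Z\<^esub> y = \<zero>\<^bsub>?Z\<^esub>" "x \<in> carrier ?Z" "y \<in> carrier ?Z"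
    show "x = \<zero>\<^bsub>?Z\<^esub> \<or> y = \<zero>\<^bsub>?Z\<^esub>"
    proof (rule ccontr)
      assume "\<not> ?thesis"
      with xy nz obtain i j
        where i: "\<And>k. k \<ge> i \<Longrightarrow> x k \<noteq> 0 \<and> multiplicity (int p) (x k) \<le> i"
          and j: "\<And>k. k \<ge> j \<Longrightarrow> y k \<noteq> 0 \<and> multiplicity (int p) (y k) \<le> j"
        by metis
      define k where "k = i + j"
      have "prime_elem (int p)" using assms by auto
      then have "multiplicity (int p) (x k * y k) =
          multiplicity (int p) (x k) + multiplicity (int p) (y k)"
        using i[of k] j[of k] by (intro prime_elem_multiplicity_mult_distrib) (auto simp: k_def)
      also have "\<dots> < Suc k" using i[of k] j[of k] by (simp add: k_def)
      finally have "multiplicity (int p) (x k * y k) < Suc k" .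
      moreover have "int p ^ Suc k dvd x k * y k"
        using fun_cong[OF xy(1), of k]
        by (simp add: padic_integers_simps(2-) mod_eq_0_iff_dvd del: power_Suc)
      then have "Suc k \<le> multiplicity (int p) (x k * y k)"
        using i[of k] j[of k] \<open>p > 1\<close> by (intro multiplicity_geI) (auto simp: k_def)
      ultimately show False by simp
    qed
  qed
qed

lemma field_padic_numbers: "prime p \<Longrightarrow> field (padic_numbers p)"
  unfolding padic_numbers_def by (rule domain.field_fraction_field[OF domain_padic_integers])

end

theory Submission
  imports Defs "HOL-Number_Theory.Residue_Primitive_Roots"
begin

text \<open>
  By Hensel's lemma a unit of \<open>\<int>\<^sub>p\<close> is a cube as soon as it is one modulo \<open>p\<close> (modulo 9 if \<open>p = 3\<close>),
  so a \<open>p\<close>-adic integer is a sum of \<open>g\<close> cubes whenever its residue is one with a unit among the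
  summands.  Modulo 9 and modulo 7 the only cubes are 0 and \<open>\<plusminus>1\<close>.  If \<open>p \<equiv> 2\<close> modulo 3, every residue is a
  cube.  If \<open>p \<equiv> 1\<close> modulo 3, let \<open>f = (p - 1) / 3\<close> and let \<open>A, B, D, E\<close> be the cyclotomic numbers of order 3,
  that is, the numbers of solutions of \<open>x + y + z = 0\<close> for a fixed \<open>z\<close>, with the cubic classes of
  \<open>x, y, z\<close> equal to 000, 001, 002, 012.  They satisfy \<open>A + B + D + 1 = f = B + D + E\<close> and
  \<open>B D + D E + E B = A E + B\<^sup>2 + D\<^sup>2\<close>; a coset of the cubes that contains no sum of two cubes
  makes \<open>B\<close> or \<open>D\<close> vanish, and then \<open>f \<le> 2\<close>, so \<open>p = 7\<close>.

  In \<open>\<rat>\<^sub>p\<close> the obstruction disappears: \<open>p\<^sup>3 a b\<^sup>2 - 1\<close> is always a cube \<open>c\<^sup>3\<close>, whence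
  \<open>a / b = (1 / (p b))\<^sup>3 + (c / (p b))\<^sup>3\<close>.  By its valuation, \<open>p\<close> itself is not a cube.
\<close>

section \<open>Cyclotomic numbers of order 3\<close>

(* The discrete logarithm modulo 3: the units of class 0 are the cubes.  The values of \<chi> on
   multiples of p carry no meaning. *)
locale cubic_character =
  fixes p :: int and \<chi> :: "int \<Rightarrow> nat"
  assumes prime: "prime p"
    and chi_less: "\<chi> x < 3"
    and chi_cong: "[x = y] (mod p) \<Longrightarrow> \<chi> x = \<chi> y"
    and chi_mult: "\<not> p dvd x \<Longrightarrow> \<not> p dvd y \<Longrightarrow> \<chi> (x * y) = (\<chi> x + \<chi> y) mod 3"
    and chi_onto: "\<exists>g. \<not> p dvd g \<and> \<chi> g = 1"
begin

section \<open>Cubic classes and solution counts\<close>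

definition C :: "nat \<Rightarrow> int set" where
  "C i = {x \<in> {1..<p}. \<chi> x = i}"

text \<open>The equation is kept in the homogeneous form x + y + z = 0, so that scaling and
  permuting the three variables are visible symmetries.\<close>

definition N :: "nat \<Rightarrow> nat \<Rightarrow> int \<Rightarrow> nat" where
  "N i j z = card {(x, y) \<in> C i \<times> C j. p dvd x + y + z}"

lemma p_gt_1: "p > 1"
  using prime by (rule prime_gt_1_int)

lemma dvd_mult_iff: "p dvd x * y \<longleftrightarrow> p dvd x \<or> p dvd y"
  using prime by (rule prime_dvd_mult_iff)

lemma finite_C [simp]: "finite (C i)"
  by (rule finite_subset[of _ "{1..<p}"]) (auto simp: C_def)

lemma mod_in_C_iff: "x mod p \<in> C i \<longleftrightarrow> \<not> p dvd x \<and> \<chi> x = i"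
proof -
  have "\<chi> (x mod p) = \<chi> x"
    by (rule chi_cong) simp
  moreover have "x mod p \<ge> 0" "x mod p < p"
    using p_gt_1 by simp_all
  then have "x mod p \<in> {1..<p} \<longleftrightarrow> x mod p \<noteq> 0"
    by auto
  ultimately show ?thesis
    unfolding C_def mem_Collect_eq dvd_eq_mod_eq_0 by simp
qed

lemma C_D: "x \<in> C i \<Longrightarrow> \<not> p dvd x" "x \<in> C i \<Longrightarrow> \<chi> x = i"
    "x \<in> C i \<Longrightarrow> x mod p = x"
  by (auto simp: C_def dest: zdvd_imp_le)

lemma C_disjoint: "i \<noteq> j \<Longrightarrow> C i \<inter> C j = {}"
  by (auto simp: C_def)

lemma inverse_mod_p:
  assumes "\<not> p dvd x"
  obtains y where "[x * y = 1] (mod p)" "\<not> p dvd y"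
proof -
  have "coprime x p"
    using assms prime by (simp add: coprime_commute prime_imp_coprime)
  then obtain y where y: "[x * y = 1] (mod p)"
    using cong_solve_coprime_int by blast
  moreover have "\<not> p dvd y"
    using y p_gt_1 by (metis cong_dvd_iff dvd_mult one_dvd zdvd_not_zless zero_less_one)
  ultimately show ?thesis
    using that by blast
qed

lemma chi_1: "\<chi> 1 = 0"
proof -
  have "\<chi> 1 = (\<chi> 1 + \<chi> 1) mod 3"
    using chi_mult[of 1 1] p_gt_1 by (simp add: zdvd_not_zless)
  moreover have "\<chi> 1 = 0 \<or> \<chi> 1 = 1 \<or> \<chi> 1 = 2"
    using chi_less[of 1] by linarith
  ultimately show ?thesis
    by (elim disjE) simp_all
qed

text \<open>Twice the class of -1 is the class of 1, which is 0, and 2 is invertible modulo 3. Hence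
  signs never matter: x + y + z = 0 also counts representations of z as a sum of two
  elements.\<close>

lemma chi_uminus:
  assumes "\<not> p dvd x"
  shows "\<chi> (- x) = \<chi> x"
proof -
  have u: "\<not> p dvd - 1"
    using p_gt_1 by (simp add: zdvd_not_zless)
  have "\<chi> (- 1) < 3" "\<chi> ((- 1) * (- 1)) = (\<chi> (- 1) + \<chi> (- 1)) mod 3"
    using chi_less chi_mult[OF u u] by simp_all
  then have "\<chi> (- 1) = 0"
    using chi_1 by simp presburger
  then show ?thesis
    using chi_mult[OF u assms] chi_less[of x] by simp
qed

lemma N_cong:
  assumes "[z = z'] (mod p)"
  shows "N i j z = N i j z'"
proof -
  have "p dvd x + y + z \<longleftrightarrow> p dvd x + y + z'" for x y
    by (rule cong_dvd_iff) (intro cong_add cong_refl assms)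
  then show ?thesis
    by (simp add: N_def)
qed

lemma N_commute: "N i j z = N j i z"
proof -
  have "{(x, y) \<in> C j \<times> C i. p dvd x + y + z} =
        prod.swap ` {(x, y) \<in> C i \<times> C j. p dvd x + y + z}"
    by (auto simp: image_iff add_ac)
  then show ?thesis
    unfolding N_def by (simp add: card_image)
qed

lemma mult_mod_inj:
  assumes "\<not> p dvd w" "x \<in> C i" "y \<in> C j" "w * x mod p = w * y mod p"
  shows "x = y"
proof -
  have "p dvd w * (x - y)"
    using assms(4) by (simp add: mod_eq_dvd_iff right_diff_distrib)
  then have "p dvd x - y"
    using assms(1) by (simp add: dvd_mult_iff)
  then have "x mod p = y mod p"
    by (simp add: mod_eq_dvd_iff)
  then show ?thesis
    using assms C_D by metis
qed

text \<open>Multiplication by the unit \<open>w\<close> maps solutions injectively to solutions and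
  adds \<open>\<chi> w\<close> to all classes.\<close>

lemma N_scale_le:
  assumes "\<not> p dvd w"
  shows "N i j z \<le> N ((i + \<chi> w) mod 3) ((j + \<chi> w) mod 3) (w * z)"
  unfolding N_def
proof (rule card_inj_on_le)
  let ?f = "\<lambda>(x, y). (w * x mod p, w * y mod p)"
  show "inj_on ?f {(x, y) \<in> C i \<times> C j. p dvd x + y + z}"
    using mult_mod_inj[OF assms] by (auto simp: inj_on_def)
  have "p dvd w * x mod p + w * y mod p + w * z" if "p dvd x + y + z" for x y
  proof -
    have "[w * x mod p + w * y mod p + w * z = w * x + w * y + w * z] (mod p)"
      by (intro cong_add) simp_all
    moreover have "p dvd w * x + w * y + w * z"
      using that by (metis distrib_left dvd_mult)
    ultimately show ?thesis
      by (simp add: cong_dvd_iff)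
  qed
  then show "?f ` {(x, y) \<in> C i \<times> C j. p dvd x + y + z} \<subseteq>
      {(x, y) \<in> C ((i + \<chi> w) mod 3) \<times> C ((j + \<chi> w) mod 3). p dvd x + y + w * z}"
    using assms by (auto simp: mod_in_C_iff dvd_mult_iff chi_mult C_D add.commute)
  show "finite {(x, y) \<in> C ((i + \<chi> w) mod 3) \<times> C ((j + \<chi> w) mod 3). p dvd x + y + w * z}"
    by (rule finite_subset[of _ "C ((i + \<chi> w) mod 3) \<times> C ((j + \<chi> w) mod 3)"]) auto
qed

text \<open>The reverse inequality is \<open>N_scale_le\<close> for an inverse \<open>v\<close> of
  \<open>w\<close>; since \<open>i\<close> and \<open>j\<close> are below 3, shifting back restores
  them exactly.\<close>

lemma N_scale:
  assumes "\<not> p dvd w" "i < 3" "j < 3"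
  shows "N ((i + \<chi> w) mod 3) ((j + \<chi> w) mod 3) (w * z) = N i j z"
proof (rule antisym)
  obtain v where v: "[w * v = 1] (mod p)" "\<not> p dvd v"
    using inverse_mod_p assms(1) by blast
  have "(\<chi> w + \<chi> v) mod 3 = 0"
    using chi_mult[OF assms(1) v(2)] chi_cong[OF v(1)] chi_1 by simp
  then have e: "((i + \<chi> w) mod 3 + \<chi> v) mod 3 = i" if "i < 3" for i
  proof -
    have "((i + \<chi> w) mod 3 + \<chi> v) mod 3 = (i + (\<chi> w + \<chi> v) mod 3) mod 3"
      by (simp add: mod_simps add.assoc)
    also have "\<dots> = i"
      using that \<open>(\<chi> w + \<chi> v) mod 3 = 0\<close> by simp
    finally show ?thesis .
  qed
  have "[v * (w * z) = z] (mod p)"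
    using cong_scalar_right[OF v(1), of z] by (simp add: mult_ac)
  from N_cong[OF this] show "N ((i + \<chi> w) mod 3) ((j + \<chi> w) mod 3) (w * z) \<le> N i j z"
    using N_scale_le[OF v(2), of "(i + \<chi> w) mod 3" "(j + \<chi> w) mod 3" "w * z"]
    by (simp only: e[OF assms(2)] e[OF assms(3)])
qed (rule N_scale_le[OF assms(1)])

text \<open>The quotient of \<open>z'\<close> by \<open>z\<close> has class 0, so scaling by it
  changes \<open>z\<close> to \<open>z'\<close> but leaves \<open>i\<close> and \<open>j\<close>
  fixed.\<close>

lemma N_eq:
  assumes "\<not> p dvd z" "\<not> p dvd z'" "\<chi> z = \<chi> z'" "i < 3" "j < 3"
  shows "N i j z = N i j z'"
proof -
  obtain v where v: "[z * v = 1] (mod p)" "\<not> p dvd v"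
    using inverse_mod_p assms(1) by blast
  have u: "\<not> p dvd z' * v"
    using assms v by (simp add: dvd_mult_iff)
  have "(\<chi> z + \<chi> v) mod 3 = 0"
    using chi_mult[OF assms(1) v(2)] chi_cong[OF v(1)] chi_1 by simp
  then have "\<chi> (z' * v) = 0"
    using assms v by (simp add: chi_mult)
  then have "N i j (z' * v * z) = N i j z"
    using N_scale[OF u assms(4,5), of z] assms by simp
  moreover have "[z' * v * z = z'] (mod p)"
    using cong_scalar_right[OF v(1), of z'] by (simp add: mult_ac)
  ultimately show ?thesis
    using N_cong by metis
qed

lemma card_C_le:
  assumes "\<not> p dvd w"
  shows "card (C i) \<le> card (C ((i + \<chi> w) mod 3))"
proof (rule card_inj_on_le)
  show "inj_on (\<lambda>x. w * x mod p) (C i)"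
    using mult_mod_inj[OF assms] by (auto simp: inj_on_def)
  show "(\<lambda>x. w * x mod p) ` C i \<subseteq> C ((i + \<chi> w) mod 3)"
    using assms by (auto simp: mod_in_C_iff dvd_mult_iff chi_mult C_D add.commute)
qed simp

text \<open>Scaling by an element of class 1 gives a cyclic chain of inequalities between the three
  classes; so they have equal size, and together they exhaust the nonzero residues.\<close>

lemma card_C:
  assumes "i < 3"
  shows "3 * int (card (C i)) = p - 1"
proof -
  obtain g where g: "\<not> p dvd g" "\<chi> g = 1"
    using chi_onto by blast
  have step: "card (C i) \<le> card (C j)" if "(i + 1) mod 3 = j" for i j
    using card_C_le[OF g(1), of i] unfolding g(2) that .
  have le: "card (C 0) \<le> card (C 1)" "card (C 1) \<le> card (C 2)" "card (C 2) \<le> card (C 0)"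
    by (rule step, simp)+
  have "{1..<p} = C 0 \<union> (C 1 \<union> C 2)"
  proof -
    have "\<chi> x = 0 \<or> \<chi> x = 1 \<or> \<chi> x = 2" for x
      using chi_less[of x] by linarith
    then show ?thesis
      unfolding C_def by blast
  qed
  moreover have "card (C 0 \<union> (C 1 \<union> C 2)) = card (C 0) + card (C 1 \<union> C 2)"
    by (rule card_Un_disjoint) (simp_all add: C_disjoint Int_Un_distrib)
  moreover have "card (C 1 \<union> C 2) = card (C 1) + card (C 2)"
    by (rule card_Un_disjoint) (simp_all add: C_disjoint Int_Un_distrib)
  ultimately have "card {1..<p} = card (C 0) + (card (C 1) + card (C 2))"
    by simp
  moreover have "int (card {1..<p}) = p - 1"
    using p_gt_1 by simp
  moreover note le
  ultimately have "card (C 1) = card (C 0)" "card (C 2) = card (C 0)" "3 * int (card (C 0)) = p - 1"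
    by linarith+
  moreover have "i = 0 \<or> i = 1 \<or> i = 2"
    using assms by linarith
  ultimately show ?thesis
    by metis
qed

lemma N_eq_sum: "N i j z = (\<Sum>x\<in>C i. \<Sum>y\<in>C j. of_bool (p dvd x + y + z))"
proof -
  have "{(x, y) \<in> C i \<times> C j. p dvd x + y + z} = (SIGMA x:C i. {y \<in> C j. p dvd x + y + z})"
    by auto
  then show ?thesis
    unfolding N_def by (simp add: Int_def)
qed

text \<open>Double counting of the solutions with all three variables free in \<open>C i\<close>,
  \<open>C j\<close>, \<open>C k\<close>: by \<open>N_eq\<close> each fixed \<open>z\<close>, or
  each fixed \<open>y\<close>, contributes equally, and the class sizes cancel.\<close>

lemma N_rotate:
  assumes "y \<in> C j" "z \<in> C k" "i < 3"
  shows "N i j z = N i k y"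
proof -
  have jk: "j < 3" "k < 3"
    using assms C_D chi_less by metis+
  have const: "(\<Sum>c\<in>C b. N i a c) = card (C b) * N i a d" if "d \<in> C b" "a < 3" for a b d
  proof -
    have "(\<Sum>c\<in>C b. N i a c) = (\<Sum>c\<in>C b. N i a d)"
      using that assms(3) C_D by (intro sum.cong refl N_eq) auto
    then show ?thesis by simp
  qed
  have "card (C k) * N i j z = (\<Sum>z\<in>C k. N i j z)"
    by (rule const[symmetric]) (fact assms jk)+
  also have "\<dots> = (\<Sum>x\<in>C i. \<Sum>y\<in>C j. \<Sum>z\<in>C k. of_bool (p dvd x + y + z))"
    unfolding N_eq_sum by (subst sum.swap, rule sum.cong[OF refl], subst sum.swap, rule refl)
  also have "\<dots> = (\<Sum>x\<in>C i. \<Sum>z\<in>C k. \<Sum>y\<in>C j. of_bool (p dvd x + z + y))"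
    by (rule sum.cong[OF refl], subst sum.swap, simp add: add_ac)
  also have "\<dots> = (\<Sum>y\<in>C j. N i k y)"
    unfolding N_eq_sum by (subst (2) sum.swap, rule sum.cong[OF refl], subst sum.swap, rule refl)
  also have "\<dots> = card (C j) * N i k y"
    by (rule const) (fact assms jk)+
  finally have "card (C k) * N i j z = card (C j) * N i k y" .
  moreover have "card (C k) = card (C j)" "card (C k) \<noteq> 0"
    using card_C[OF jk(1)] card_C[OF jk(2)] p_gt_1 by linarith+
  ultimately show ?thesis by simp
qed


section \<open>Cyclotomic numbers and the relations between them\<close>

definition cyc :: "nat \<Rightarrow> nat \<Rightarrow> nat \<Rightarrow> nat" where
  "cyc i j k = N i j (SOME z. \<not> p dvd z \<and> \<chi> z = k)"

lemma ex_class: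
  assumes "k < 3"
  shows "\<exists>z. \<not> p dvd z \<and> \<chi> z = k"
proof -
  have "card (C k) \<noteq> 0"
    using card_C[OF assms] p_gt_1 by linarith
  then have "C k \<noteq> {}"
    by auto
  then show ?thesis
    using C_D by blast
qed

text \<open>Frees \<open>cyc\<close> from its arbitrary representative: by \<open>N_eq\<close> only
  the class of \<open>z\<close> counts.\<close>

lemma N_eq_cyc:
  assumes "\<not> p dvd z" "i < 3" "j < 3"
  shows "N i j z = cyc i j (\<chi> z)"
  unfolding cyc_def using someI_ex[OF ex_class[OF chi_less[of z]]] assms
  by (intro N_eq) auto

lemma cyc_commute: "cyc i j k = cyc j i k"
  unfolding cyc_def by (rule N_commute)

lemma cyc_rotate:
  assumes "i < 3" "j < 3" "k < 3"
  shows "cyc i j k = cyc i k j"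
proof -
  obtain y where y: "\<not> p dvd y" "\<chi> y = j"
    using ex_class assms by blast
  obtain z where z: "\<not> p dvd z" "\<chi> z = k"
    using ex_class assms by blast
  have y': "y mod p \<in> C j" and z': "z mod p \<in> C k"
    using y z by (simp_all add: mod_in_C_iff)
  have "cyc i j k = N i j (z mod p)"
    using z z' assms C_D[OF z'] by (subst N_eq_cyc) auto
  also have "\<dots> = N i k (y mod p)"
    by (rule N_rotate) (fact y' z' assms)+
  also have "\<dots> = cyc i k j"
    using y y' assms C_D[OF y'] by (subst N_eq_cyc) auto
  finally show ?thesis .
qed

lemma cyc_shift:
  assumes "i < 3" "j < 3" "k < 3"
    and "(i + 1) mod 3 = i'" "(j + 1) mod 3 = j'" "(k + 1) mod 3 = k'"
  shows "cyc i' j' k' = cyc i j k"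
proof -
  obtain g where g: "\<not> p dvd g" "\<chi> g = 1"
    using chi_onto by blast
  obtain z where z: "\<not> p dvd z" "\<chi> z = k"
    using ex_class assms by blast
  have "N ((i + 1) mod 3) ((j + 1) mod 3) (g * z) = N i j z"
    using N_scale[OF g(1) assms(1,2), of z] unfolding g(2) .
  moreover have "\<chi> (g * z) = (k + 1) mod 3" "\<not> p dvd g * z"
    using chi_mult[OF g(1) z(1)] g z by (simp_all add: dvd_mult_iff add.commute)
  ultimately show ?thesis
    using N_eq_cyc[of z i j] N_eq_cyc[of "g * z" "i'" "j'"] z assms by auto
qed

text \<open>The second variable is determined by the first as the residue of -(x + z), which has the
  class of x + z because -1 is a cube.\<close>

lemma card_class_shift:
  assumes "k < 3"
  shows "card {x \<in> C i. \<not> p dvd x + z \<and> \<chi> (x + z) = k} = N i k z"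
proof -
  have "{(x, y) \<in> C i \<times> C k. p dvd x + y + z} =
      (\<lambda>x. (x, (- (x + z)) mod p)) ` {x \<in> C i. \<not> p dvd x + z \<and> \<chi> (x + z) = k}"
  proof (intro equalityI subsetI; clarsimp simp: image_iff)
    fix x y assume *: "x \<in> C i" "y \<in> C k" "p dvd x + y + z"
    then have "(- (x + z)) mod p = y mod p"
      by (simp add: mod_eq_dvd_iff) (metis add.commute add.left_commute diff_minus_eq_add dvd_minus_iff minus_add_distrib minus_diff_eq)
    then have "y = (- (x + z)) mod p"
      using C_D *(2) by simp
    moreover from this have "\<not> p dvd x + z" "\<chi> (x + z) = k"
      using *(2) mod_in_C_iff[of "- (x + z)" k] chi_uminus[of "x + z"] dvd_minus_iff[of p "x + z"] by auto
    ultimately show "\<not> p dvd x + z \<and> \<chi> (x + z) = k \<and> y = (- x - z) mod p"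
      by simp
  next
    fix x assume *: "x \<in> C i" "\<not> p dvd x + z" "k = \<chi> (x + z)"
    have "[x + (- (x + z)) mod p + z = x + (- (x + z)) + z] (mod p)"
      by (intro cong_add) simp_all
    then have "p dvd x + (- (x + z)) mod p + z"
      by (simp add: cong_0_iff)
    then show "(- x - z) mod p \<in> C (\<chi> (x + z)) \<and> p dvd x + (- x - z) mod p + z"
      using * mod_in_C_iff[of "- (x + z)" k] chi_uminus[of "x + z"] dvd_minus_iff[of p "x + z"] by auto
  qed
  then show ?thesis
    unfolding N_def by (simp add: card_image inj_on_def)
qed

text \<open>Constant \<open>F\<close> yields the row sums below, and \<open>F = cyc a b\<close>
  yields the quadratic relation.\<close>

lemma sum_by_class:
  fixes F :: "nat \<Rightarrow> nat"
  assumes "\<not> p dvd z" "i < 3"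
  shows "(\<Sum>x\<in>{x \<in> C i. \<not> p dvd x + z}. F (\<chi> (x + z))) =
    F 0 * cyc i 0 (\<chi> z) + F 1 * cyc i 1 (\<chi> z) + F 2 * cyc i 2 (\<chi> z)"
proof -
  let ?S = "{x \<in> C i. \<not> p dvd x + z}"
  have F: "F (\<chi> t) = F 0 * of_bool (\<chi> t = 0) + F 1 * of_bool (\<chi> t = 1) + F 2 * of_bool (\<chi> t = 2)" for t
    using chi_less[of t] by (auto simp: numeral_3_eq_3 less_Suc_eq)
  have "(\<Sum>x\<in>?S. of_bool (\<chi> (x + z) = k)) = cyc i k (\<chi> z)" if "k < 3" for k
  proof -
    have "(\<Sum>x\<in>?S. of_bool (\<chi> (x + z) = k) :: nat) = card {x \<in> C i. \<not> p dvd x + z \<and> \<chi> (x + z) = k}"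
      by (simp add: Int_def conj_assoc)
    then show ?thesis
      using card_class_shift that N_eq_cyc assms by simp
  qed
  then show ?thesis
    by (subst F) (simp only: sum.distrib sum_distrib_left[symmetric])
qed


text \<open>The indicator accounts for the only element with x + z = 0, namely the residue of -z,
  which has class \<open>k\<close>.\<close>

lemma cyc_row_sum:
  assumes "i < 3" "k < 3"
  shows "cyc i 0 k + cyc i 1 k + cyc i 2 k + of_bool (i = k) = card (C i)"
proof -
  obtain z where z: "\<not> p dvd z" "\<chi> z = k"
    using ex_class assms by blast
  have z': "{x \<in> C i. p dvd x + z} = (if i = k then {(- z) mod p} else {})"
  proof -
    have "x \<in> C i \<and> p dvd x + z \<longleftrightarrow> x = (- z) mod p \<and> i = k" for x
    proof
      assume *: "x \<in> C i \<and> p dvd x + z"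
      then have "x mod p = (- z) mod p"
        by (simp add: mod_eq_dvd_iff)
      then have "x = (- z) mod p"
        using * C_D(3)[of x i] by simp
      then show "x = (- z) mod p \<and> i = k"
        using * mod_in_C_iff[of "- z" i] chi_uminus[OF z(1)] z(2) by simp
    next
      assume *: "x = (- z) mod p \<and> i = k"
      have "[(- z) mod p + z = - z + z] (mod p)"
        by (intro cong_add) simp_all
      then show "x \<in> C i \<and> p dvd x + z"
        using * mod_in_C_iff[of "- z" i] chi_uminus[OF z(1)] z by (simp add: cong_0_iff)
    qed
    then show ?thesis by auto
  qed
  have "card (C i) = card ({x \<in> C i. \<not> p dvd x + z} \<union> {x \<in> C i. p dvd x + z})"
    by (rule arg_cong[where f = card]) auto
  also have "\<dots> = card {x \<in> C i. \<not> p dvd x + z} + card {x \<in> C i. p dvd x + z}"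
    by (rule card_Un_disjoint) auto
  also have "card {x \<in> C i. \<not> p dvd x + z} = cyc i 0 k + cyc i 1 k + cyc i 2 k"
    using sum_by_class[OF z(1) assms(1), of "\<lambda>_. 1"] z(2) by simp
  finally show ?thesis
    unfolding z' by (simp split: if_splits)
qed

text \<open>Both sides count the triples in \<open>C a\<close>, \<open>C b\<close>,
  \<open>C c\<close> whose sum is congruent to -z; only the variable summed last differs.\<close>

lemma sum_N_swap: "(\<Sum>x\<in>C a. N b c (x + z)) = (\<Sum>y\<in>C c. N a b (y + z))"
proof -
  have "(\<Sum>x\<in>C a. N b c (x + z)) =
      (\<Sum>x\<in>C a. \<Sum>y\<in>C c. \<Sum>w\<in>C b. of_bool (p dvd w + y + (x + z)))"
    unfolding N_eq_sum by (rule sum.cong[OF refl], rule sum.swap)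
  also have "\<dots> = (\<Sum>y\<in>C c. \<Sum>x\<in>C a. \<Sum>w\<in>C b. of_bool (p dvd w + y + (x + z)))"
    by (rule sum.swap)
  also have "\<dots> = (\<Sum>y\<in>C c. N a b (y + z))"
    unfolding N_eq_sum by (intro sum.cong refl) (simp add: ac_simps)
  finally show ?thesis .
qed

text \<open>This is associativity of the multiplication of Gaussian periods: solutions of
  \<open>x + x' + y + z = 0\<close> with \<open>x, x'\<close> of class 0 and \<open>y\<close> of class 1
  are counted by the class of \<open>x' + y\<close> and by the class of \<open>x + x'\<close>.\<close>

lemma cyc_quadratic:
  "cyc 0 1 0 * cyc 0 0 2 + cyc 0 1 1 * cyc 0 1 2 + cyc 0 1 2 * cyc 0 2 2 =
   cyc 0 0 0 * cyc 1 0 2 + cyc 0 0 1 * cyc 1 1 2 + cyc 0 0 2 * cyc 1 2 2"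
proof -
  obtain z where z: "\<not> p dvd z" "\<chi> z = 2"
    using ex_class[of 2] by auto
  \<comment> \<open>This is why \<open>z\<close> has class 2: -z then has class 2 as well and cannot
    lie in class 0 or 1, so no degenerate term x + z = 0 arises on either side.\<close>
  have nz: "\<not> p dvd x + z" if "x \<in> C i" "i < 2" for x i
  proof
    assume "p dvd x + z"
    then have "[x = - z] (mod p)"
      by (simp add: cong_iff_dvd_diff)
    then have "\<chi> x = \<chi> z"
      using chi_cong chi_uminus[OF z(1)] by metis
    then show False
      using that C_D(2) z(2) by fastforce
  qed
  have "(\<Sum>x\<in>C i. N a b (x + z)) = cyc a b 0 * cyc i 0 2 + cyc a b 1 * cyc i 1 2 + cyc a b 2 * cyc i 2 2"
    if "i < 2" "a < 3" "b < 3" for i a b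
  proof -
    have "{x \<in> C i. \<not> p dvd x + z} = C i"
      using nz that by auto
    moreover have "(\<Sum>x\<in>C i. N a b (x + z)) = (\<Sum>x\<in>C i. cyc a b (\<chi> (x + z)))"
      using nz that N_eq_cyc by (intro sum.cong) auto
    ultimately show ?thesis
      using sum_by_class[OF z(1), of i "cyc a b"] that z(2) by simp
  qed
  from this[of 0 0 1] this[of 1 0 0] show ?thesis
    using sum_N_swap[of 0 1 z 0] sum_N_swap[of 0 0 z 1] cyc_commute by simp
qed

text \<open>Equivalently, each class of noncubes consists of sums of two nonzero cubes. If the count
  vanished, the relations would leave only \<open>p = 4\<close> or \<open>p = 7\<close>.\<close>

lemma cyc_00_pos:
  assumes "p \<noteq> 7" "k < 3" "k \<noteq> 0"
  shows "cyc 0 0 k \<noteq> 0"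
proof
  assume nk: "cyc 0 0 k = 0"
  define A B D E where "A = cyc 0 0 0" and "B = cyc 0 0 1" and "D = cyc 0 0 2" and "E = cyc 0 1 2"
  \<comment> \<open>Up to permutation and a common shift of the classes there are only four triples:
    000, 001, 002, 012.\<close>
  have shift: "cyc 1 1 2 = cyc 0 0 1" "cyc 2 2 0 = cyc 1 1 2" "cyc 1 1 0 = cyc 0 0 2" "cyc 2 2 1 = cyc 1 1 0"
    by (rule cyc_shift; simp)+
  have rotate: "cyc 0 0 1 = cyc 0 1 0" "cyc 1 1 2 = cyc 1 2 1" "cyc 2 2 0 = cyc 2 0 2"
      "cyc 0 0 2 = cyc 0 2 0" "cyc 1 1 0 = cyc 1 0 1" "cyc 2 2 1 = cyc 2 1 2"
    by (rule cyc_rotate; simp)+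
  have B: "cyc 0 1 0 = B" "cyc 1 0 0 = B" "cyc 1 1 2 = B" "cyc 1 2 1 = B" "cyc 0 2 2 = B"
    unfolding B_def using shift rotate cyc_commute by metis+
  have D: "cyc 0 1 1 = D" "cyc 1 2 2 = D" "cyc 0 2 0 = D"
    unfolding D_def using shift rotate cyc_commute by metis+
  have E: "cyc 1 0 2 = E" "cyc 0 2 1 = E"
    using cyc_commute[of 1 0 2] cyc_rotate[of 0 2 1] by (simp_all add: E_def)
  define f where "f = card (C 0)"
  have 1: "A + B + D + 1 = f" "B + D + E = f"
    using cyc_row_sum[of 0 0] cyc_row_sum[of 0 1] B D E
    by (simp_all add: f_def A_def B_def D_def E_def)
  have 2: "B * D + D * E + E * B = A * E + B * B + D * D"
    using cyc_quadratic unfolding B D E by (simp add: A_def B_def D_def E_def)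
  have "k = 1 \<or> k = 2"
    using assms by linarith
  then have "B = 0 \<or> D = 0"
    using nk by (auto simp: B_def D_def)
  \<comment> \<open>The relations are symmetric in \<open>B\<close> and \<open>D\<close>;
    \<open>X\<close> is whichever of the two is not known to vanish.\<close>
  then obtain X where X: "A + X + 1 = f" "X + E = f" "E * X = A * E + X * X"
  proof
    assume "B = 0"
    then show ?thesis using that[of D] 1 2 by (simp add: mult.commute)
  next
    assume "D = 0"
    then show ?thesis using that[of B] 1 2 by (simp add: mult.commute)
  qed
  have E: "E = A + 1"
    using X by simp
  have "int X * (A + 1) = A * (A + 1) + X * X"
    using X(3) unfolding E by (simp add: algebra_simps flip: of_nat_mult of_nat_add)
  \<comment> \<open>In terms of this difference the quadratic relation reads d^2 + A X = d. So
    \<open>d\<close> is 0 or 1 and A X = 0, which forces \<open>A = 0\<close> and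
    \<open>X = d\<close>, hence \<open>f = d + 1\<close>.\<close>
  moreover define d where "d = int X - A"
  ultimately have *: "d * d + int A * X = d"
    unfolding d_def by (simp add: algebra_simps)
  moreover have "d * d \<ge> 0" "int A * X \<ge> 0"
    by simp_all
  ultimately have "d \<ge> 0" "d * d \<le> d"
    by linarith+
  then have "d = 0 \<or> d = 1"
    using mult_right_mono[of 2 d d] by linarith
  then have "f = 1 \<or> f = 2"
    using * X(1) by (auto simp: d_def)
  then have "p = 4 \<or> p = 7"
    using card_C[of 0] by (auto simp: f_def)
  moreover have "p \<noteq> 4"
  proof
    assume "p = 4"
    then have "(2::int) dvd 2 * 2" "p = 2 * 2" by simp_all
    then have "p dvd 2"
      using dvd_mult_iff[of 2 2] by simp
    then show False
      using \<open>p = 4\<close> by simp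
  qed
  ultimately show False
    using assms(1) by simp
qed

text \<open>The solutions of x + y - a = 0 in class 0 are counted by
  \<open>cyc 0 0 (\<chi> a)\<close>, as -a has the class of \<open>a\<close>.\<close>

lemma sum_of_two_class_zero:
  assumes "p \<noteq> 7" "\<not> p dvd a"
  shows "\<chi> a = 0 \<or> (\<exists>x y. \<chi> x = 0 \<and> \<chi> y = 0 \<and> \<not> p dvd x \<and> \<not> p dvd y \<and> [x + y = a] (mod p))"
proof (cases "\<chi> a = 0")
  case False
  then have "N 0 0 (- a) \<noteq> 0"
    using cyc_00_pos[OF assms(1) chi_less False] N_eq_cyc[of "- a" 0 0] chi_uminus assms by simp
  then have "{(x, y) \<in> C 0 \<times> C 0. p dvd x + y + - a} \<noteq> {}"
    unfolding N_def by (metis card.empty)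
  then obtain x y where xy: "x \<in> C 0" "y \<in> C 0" "p dvd x + y - a"
    by auto
  then show ?thesis
    using C_D[OF xy(1)] C_D[OF xy(2)] by (auto simp: cong_iff_dvd_diff)
qed simp

end


section \<open>Cubes modulo a prime\<close>

text \<open>Discrete logarithms to a primitive root \<open>g\<close> are unique modulo p - 1. As 3
  divides p - 1, they have a well-defined residue modulo 3, and a logarithm divisible by 3 exhibits
  a cube root.\<close>

lemma cubic_character_exists:
  fixes p :: nat
  assumes "prime p" "[p = 1] (mod 3)"
  obtains \<chi> where "cubic_character (int p) \<chi>"
    "\<And>x. \<not> int p dvd x \<Longrightarrow> \<chi> x = 0 \<Longrightarrow> \<exists>y. [x = y ^ 3] (mod int p)"
proof -
  have p1: "p > 1"
    using assms(1) by (rule prime_gt_1_nat)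
  have "3 dvd p - 1"
    using assms(2) by (rule cong_to_1_nat)
  obtain g where g: "residue_primroot p g"
    using prime_primitive_root_exists[OF p1 assms(1)] by blast
  then have gp: "coprime p g" "ord p g = p - 1"
    using assms(1) by (simp_all add: residue_primroot_def totient_prime)
  have log: "\<exists>i. [x = int g ^ i] (mod int p)" if "\<not> int p dvd x" for x
  proof -
    have "nat (x mod int p) \<in> totatives p"
    proof -
      have "x mod int p > 0"
        using that p1 pos_mod_sign[of "int p" x] by (simp add: dvd_eq_mod_eq_0 order_le_neq_trans[OF _ not_sym])
      moreover have "x mod int p < int p"
        using p1 by simp
      ultimately show ?thesis
        using assms(1) by (simp add: totatives_prime nat_less_iff)
    qed
    moreover have "(\<lambda>i. g ^ i mod p) ` {..<totient p} = totatives p"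
      using residue_primroot_is_generator[OF p1 g] by (simp add: bij_betw_def)
    ultimately obtain i where "g ^ i mod p = nat (x mod int p)"
      by (metis (no_types, lifting) imageE)
    then have "int (g ^ i mod p) = x mod int p"
      using p1 by simp
    then show ?thesis
      by (intro exI[of _ i]) (simp add: cong_def of_nat_mod)
  qed
  \<comment> \<open>The default 0 keeps \<open>\<chi>\<close> below 3 and constant on residue
    classes also at multiples of \<open>p\<close>, which have no logarithm.\<close>
  define \<chi> where "\<chi> x = (if int p dvd x then 0 else (SOME i. [x = int g ^ i] (mod int p)) mod 3)" for x
  have chi: "\<chi> x = i mod 3" if "\<not> int p dvd x" "[x = int g ^ i] (mod int p)" for x i
  proof -
    define j where "j = (SOME j. [x = int g ^ j] (mod int p))"
    have "[x = int g ^ j] (mod int p)"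
      unfolding j_def by (rule someI) (rule that(2))
    then have "[int (g ^ j) = int (g ^ i)] (mod int p)"
      using that(2) by (simp add: cong_def)
    then have "[g ^ j = g ^ i] (mod p)"
      by (simp only: cong_int_iff)
    then have "[j = i] (mod (p - 1))"
      using order_divides_expdiff[OF gp(1)] gp(2) by simp
    then have "[j = i] (mod 3)"
      using \<open>3 dvd p - 1\<close> by (rule cong_dvd_modulus_nat)
    then show ?thesis
      using that(1) by (simp add: \<chi>_def j_def cong_def)
  qed
  have pg: "\<not> int p dvd int g ^ i" for i
    using assms(1) gp(1) by (metis coprime_absorb_left int_dvd_int_iff not_prime_unit
        of_nat_power prime_dvd_power)
  have "cubic_character (int p) \<chi>"
  proof
    show "prime (int p)"
      using assms(1) by simp
    show "\<chi> x < 3" for x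
      by (simp add: \<chi>_def)
    show "\<chi> x = \<chi> y" if "[x = y] (mod int p)" for x y
      using that cong_dvd_iff[OF that] by (simp add: \<chi>_def cong_def)
    show "\<chi> (x * y) = (\<chi> x + \<chi> y) mod 3" if xy: "\<not> int p dvd x" "\<not> int p dvd y" for x y
    proof -
      obtain i where i: "[x = int g ^ i] (mod int p)"
        using log xy by blast
      obtain j where j: "[y = int g ^ j] (mod int p)"
        using log xy by blast
      have "[x * y = int g ^ (i + j)] (mod int p)"
        using cong_mult[OF i j] by (simp add: power_add)
      moreover have "\<not> int p dvd x * y"
        using xy assms(1) by (simp add: prime_dvd_mult_iff)
      ultimately show ?thesis
        using chi i j xy by (simp add: mod_simps)
    qed
    show "\<exists>g. \<not> int p dvd g \<and> \<chi> g = 1"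
      using pg[of 1] chi[of "int g" 1] by (intro exI[of _ "int g"]) simp
  qed
  moreover have "\<exists>y. [x = y ^ 3] (mod int p)" if x: "\<not> int p dvd x" "\<chi> x = 0" for x
  proof -
    obtain i where i: "[x = int g ^ i] (mod int p)"
      using log x by blast
    have "i mod 3 = 0"
      using chi[OF x(1) i] x(2) by simp
    then have "i = (i div 3) * 3"
      using div_mult_mod_eq[of i 3] by simp
    then have "[x = (int g ^ (i div 3)) ^ 3] (mod int p)"
      using i by (metis power_mult)
    then show ?thesis ..
  qed
  ultimately show ?thesis
    using that by blast
qed

text \<open>The unit \<open>u\<close> is demanded because Hensel lifting will be applied to that
  summand. For \<open>p\<close> dividing \<open>a\<close> the choice 1, -1 provides it.\<close>

lemma sum_two_cubes_mod_prime:
  fixes p :: nat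
  assumes "prime p" "[p = 1] (mod 3)" "p \<noteq> 7"
  obtains u v where "\<not> int p dvd u" "[u ^ 3 + v ^ 3 = a] (mod int p)"
proof -
  obtain \<chi> where "cubic_character (int p) \<chi>"
    and cube: "\<And>x. \<not> int p dvd x \<Longrightarrow> \<chi> x = 0 \<Longrightarrow> \<exists>y. [x = y ^ 3] (mod int p)"
    using cubic_character_exists[OF assms(1,2)] by metis
  then interpret cubic_character "int p" \<chi>
    by simp
  have unit: "\<not> int p dvd u" if "\<not> int p dvd x" "[x = u ^ 3] (mod int p)" for x u
    using that cong_dvd_iff dvd_power[of 3 u] dvd_trans by (metis zero_less_numeral)
  show ?thesis
  proof (cases "int p dvd a")
    case True
    then have "[1 ^ 3 + (- 1) ^ 3 = a] (mod int p)"
      by (simp add: cong_0_iff cong_sym)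
    then show ?thesis
      using that[of 1 "- 1"] p_gt_1 by simp
  next
    case False
    then consider "\<chi> a = 0"
      | x y where "\<chi> x = 0" "\<chi> y = 0" "\<not> int p dvd x" "\<not> int p dvd y" "[x + y = a] (mod int p)"
      using sum_of_two_class_zero[of a] assms(3) by auto
    then show ?thesis
    proof cases
      case 1
      then obtain u where u: "[a = u ^ 3] (mod int p)"
        using cube False by blast
      then show ?thesis
        using that[of u 0] unit[OF False u] by (simp add: cong_sym)
    next
      case 2
      then obtain u v where u: "[x = u ^ 3] (mod int p)" and v: "[y = v ^ 3] (mod int p)"
        using cube by blast
      have "[u ^ 3 + v ^ 3 = a] (mod int p)"
        using cong_trans[OF cong_add[OF cong_sym[OF u] cong_sym[OF v]] 2(5)] .
      then show ?thesis
        using that[of u v] unit[OF 2(3) u] by simp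
    qed
  qed
qed

lemma cube_root_mod_prime:
  fixes p :: nat
  assumes "prime p" "[p = 2] (mod 3)"
  obtains u where "[u ^ 3 = a] (mod int p)"
proof (cases "int p dvd a")
  case True
  then have "[0 ^ 3 = a] (mod int p)"
    by (simp add: cong_0_iff cong_sym)
  then show ?thesis ..
next
  case False
  define b where "b = nat (a mod int p)"
  have b: "int b = a mod int p"
    using assms(1) by (simp add: b_def prime_gt_0_nat)
  then have "\<not> p dvd b"
    using False by (metis dvd_mod_iff dvd_refl int_dvd_int_iff)
  then have "[b ^ (p - 1) = 1] (mod p)"
    by (rule fermat_theorem[OF assms(1)])
  then have "[int (b ^ (p - 1)) = int 1] (mod int p)"
    by (simp only: cong_int_iff)
  then have *: "[a ^ (p - 1) = 1] (mod int p)"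
    by (simp add: b cong_def power_mod)
  obtain m where "p = 3 * m + 2"
  proof
    show "p = 3 * (p div 3) + 2"
      using assms(2) div_mult_mod_eq[of p 3] by (simp add: cong_def)
  qed
  \<comment> \<open>The exponent 2m + 1 inverts 3 modulo p - 1, so by Fermat a^(2m + 1) is a cube
    root of \<open>a\<close>.\<close>
  then have e: "(p - 1) + (p - 1) + 1 = (2 * m + 1) * 3"
    by simp
  have "a ^ (p - 1) * a ^ (p - 1) * a = a ^ ((p - 1) + (p - 1) + 1)"
    by (simp only: power_add power_one_right)
  then have "a ^ (p - 1) * a ^ (p - 1) * a = (a ^ (2 * m + 1)) ^ 3"
    by (simp only: e power_mult)
  moreover have "[a ^ (p - 1) * a ^ (p - 1) * a = 1 * 1 * a] (mod int p)"
    by (intro cong_mult * cong_refl)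
  ultimately have "[(a ^ (2 * m + 1)) ^ 3 = a] (mod int p)"
    by simp
  then show ?thesis ..
qed

text \<open>The correction is a multiple of p^m, or of 3^(m - 1) if \<open>p = 3\<close>: the
  derivative 3 t^2 then supplies one factor 3, at the cost of one digit of agreement between
  \<open>t'\<close> and \<open>t\<close>. In both cases the error modulo p^(m + 1) is linear in the
  multiplier \<open>s\<close>, with a unit as coefficient.\<close>

lemma Hensel_cube_step:
  fixes p :: nat and t x :: int
  assumes "prime p" "\<not> int p dvd t" "m > of_bool (p = 3)" "[t ^ 3 = x] (mod int p ^ m)"
  obtains t' where "[t' = t] (mod int p ^ (m - of_bool (p = 3)))" "[t' ^ 3 = x] (mod int p ^ Suc m)"
proof -
  obtain d where d: "x = t ^ 3 + int p ^ m * d"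
    using assms(4) by (auto simp: cong_iff_lin)
  have solve: "\<exists>s. int p dvd c * t\<^sup>2 * s - d" if "\<not> int p dvd c" for c
  proof -
    have "coprime (c * t\<^sup>2) (int p)"
      using that assms(1,2) by (metis coprime_commute prime_dvd_mult_iff prime_dvd_power prime_imp_coprime prime_nat_int_transfer)
    then obtain w where "[c * t\<^sup>2 * w = 1] (mod int p)"
      using cong_solve_coprime_int by blast
    then have "[c * t\<^sup>2 * w * d = 1 * d] (mod int p)"
      by (rule cong_scalar_right)
    then show ?thesis
      by (intro exI[of _ "w * d"]) (simp add: cong_iff_dvd_diff mult_ac)
  qed
  show ?thesis
  proof (cases "p = 3")
    case False
    then have "\<not> p dvd 3"
      using assms(1) primes_dvd_imp_eq[of p 3] by auto
    then have "\<not> int p dvd 3"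
      by (metis int_dvd_int_iff of_nat_numeral)
    then obtain s where s: "int p dvd 3 * t\<^sup>2 * s - d"
      using solve by blast
    obtain k where m: "m = Suc k"
      using assms(3) by (cases m) auto
    have "(t + s * int p ^ m) ^ 3 - x =
        int p ^ m * (3 * t\<^sup>2 * s - d) + int p ^ Suc m * (int p ^ k * (3 * t * s\<^sup>2 + s ^ 3 * int p ^ m))"
      by (simp add: d m power2_eq_square power3_eq_cube algebra_simps)
    also have "int p ^ Suc m dvd \<dots>"
      by (intro dvd_add dvd_triv_left) (unfold power_Suc2, rule mult_dvd_mono[OF dvd_refl s])
    finally have "[(t + s * int p ^ m) ^ 3 = x] (mod int p ^ Suc m)"
      by (simp add: cong_iff_dvd_diff)
    then show ?thesis
      using that[of "t + s * int p ^ m"] False by (simp add: cong_def)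
  next
    case True
    obtain s where s: "3 dvd t\<^sup>2 * s - d"
      using solve[of 1] True by auto
    \<comment> \<open>With \<open>m\<close> at least 2 the terms of second and third order, of
      exponents 2m - 1 and 3m - 3, vanish modulo 3^(m + 1).\<close>
    obtain k where m: "m = Suc (Suc k)"
      using assms(3) True by (cases m; cases "m - 1") auto
    have "(t + s * 3 ^ (m - 1)) ^ 3 - x =
        3 ^ m * (t\<^sup>2 * s - d) + 3 ^ Suc m * (3 ^ k * (t * s\<^sup>2 + s ^ 3 * 3 ^ k))"
      by (simp add: d m True power2_eq_square power3_eq_cube algebra_simps)
    also have "3 ^ Suc m dvd \<dots>"
      by (intro dvd_add dvd_triv_left) (unfold power_Suc2, rule mult_dvd_mono[OF dvd_refl s])
    finally have "[(t + s * 3 ^ (m - 1)) ^ 3 = x] (mod int p ^ Suc m)"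
      by (simp add: cong_iff_dvd_diff True)
    then show ?thesis
      using that[of "t + s * 3 ^ (m - 1)"] True by (simp add: cong_def)
  qed
qed


section \<open>Sums of cubes of \<open>p\<close>-adic integers\<close>

lemma (in abelian_monoid) sum_of_powers_0: "sum_of_powers G m 0 x \<longleftrightarrow> x = \<zero>"
  by (auto simp: sum_of_powers_def)

lemma (in ring) sum_of_powers_closed: "sum_of_powers R m k x \<Longrightarrow> x \<in> carrier R"
  by (auto simp: sum_of_powers_def intro!: finsum_closed)

lemma (in ring) sum_of_powers_Suc:
  "sum_of_powers R m (Suc k) x \<longleftrightarrow>
    (\<exists>a\<in>carrier R. \<exists>y. sum_of_powers R m k y \<and> x = a [^] m \<oplus> y)"
proof
  assume "sum_of_powers R m (Suc k) x"
  then obtain f where f: "f \<in> {..<Suc k} \<rightarrow> carrier R" "x = (\<Oplus>i\<in>{..<Suc k}. f i [^] m)"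
    by (auto simp: sum_of_powers_def)
  have "x = f k [^] m \<oplus> (\<Oplus>i\<in>{..<k}. f i [^] m)"
    unfolding f(2) lessThan_Suc using f(1) by (subst finsum_insert) auto
  moreover have "f \<in> {..<k} \<rightarrow> carrier R" "f k \<in> carrier R"
    using f(1) by auto
  ultimately show "\<exists>a\<in>carrier R. \<exists>y. sum_of_powers R m k y \<and> x = a [^] m \<oplus> y"
    unfolding sum_of_powers_def by blast
next
  assume "\<exists>a\<in>carrier R. \<exists>y. sum_of_powers R m k y \<and> x = a [^] m \<oplus> y"
  then obtain a f where a: "a \<in> carrier R" and f: "f \<in> {..<k} \<rightarrow> carrier R"
    and x: "x = a [^] m \<oplus> (\<Oplus>i\<in>{..<k}. f i [^] m)"
    by (auto simp: sum_of_powers_def)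
  let ?g = "f(k := a)"
  have "(\<Oplus>i\<in>{..<Suc k}. ?g i [^] m) = ?g k [^] m \<oplus> (\<Oplus>i\<in>{..<k}. ?g i [^] m)"
    unfolding lessThan_Suc using a f by (subst finsum_insert) (auto simp: Pi_iff)
  also have "(\<Oplus>i\<in>{..<k}. ?g i [^] m) = (\<Oplus>i\<in>{..<k}. f i [^] m)"
    using f by (intro finsum_cong') (auto simp: Pi_iff)
  finally have "x = (\<Oplus>i\<in>{..<Suc k}. ?g i [^] m)"
    using x by simp
  moreover have "?g \<in> {..<Suc k} \<rightarrow> carrier R"
    using a f by (auto simp: Pi_iff)
  ultimately show "sum_of_powers R m (Suc k) x"
    unfolding sum_of_powers_def by blast
qed

lemma (in ring) sum_of_powers_mono:
  assumes "sum_of_powers R m k x" "k \<le> l" "m > 0"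
  shows "sum_of_powers R m l x"
  using assms(2)
proof (induction l rule: dec_induct)
  case (step l)
  then have "x = \<zero> [^] m \<oplus> x"
    using assms sum_of_powers_closed by (simp add: nat_pow_zero)
  then show ?case
    using step sum_of_powers_Suc by blast
qed (rule assms(1))

text \<open>Every element being a sum of h + 1 powers, \<open>z\<close> is subject to the bound; by
  padding with zeros it cannot be a sum of fewer than h + 1 powers either.\<close>

lemma (in ring) waring_number_eqI:
  assumes "m > 0" "h > 0"
    and all: "\<And>x. x \<in> carrier R \<Longrightarrow> sum_of_powers R m (Suc h) x"
    and z: "z \<in> carrier R" "\<not> sum_of_powers R m h z"
  shows "waring_number R m = enat (Suc h)"
  unfolding waring_number_def
proof (rule Inf_eqI)
  fix i assume "i \<in> {enat g | g. g > 0 \<and>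
     (\<forall>x \<in> carrier R. (\<exists>k. sum_of_powers R m k x) \<longrightarrow> (\<exists>k\<le>g. sum_of_powers R m k x))}"
  then obtain g k where "i = enat g" "k \<le> g" "sum_of_powers R m k z"
    using all z by blast
  moreover have "\<not> k \<le> h"
    using sum_of_powers_mono assms(1) z(2) \<open>sum_of_powers R m k z\<close> by blast
  ultimately show "enat (Suc h) \<le> i"
    by simp
next
  fix y assume "\<And>i. i \<in> {enat g | g. g > 0 \<and>
     (\<forall>x \<in> carrier R. (\<exists>k. sum_of_powers R m k x) \<longrightarrow> (\<exists>k\<le>g. sum_of_powers R m k x))} \<Longrightarrow> y \<le> i"
  then show "y \<le> enat (Suc h)"
    using all by blast
qed

section \<open>Cubes of p-adic integers and their residues\<close>

definition padic_of_int :: "nat \<Rightarrow> int \<Rightarrow> nat \<Rightarrow> int" where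
  "padic_of_int p a = (\<lambda>k. a mod int p ^ Suc k)"

lemma padic_of_int_closed: "p > 0 \<Longrightarrow> padic_of_int p a \<in> carrier (padic_integers p)"
  unfolding padic_of_int_def by (rule padic_integers_closedI) auto

lemma padic_cube: "x [^]\<^bsub>padic_integers p\<^esub> (3::nat) = (\<lambda>k. x k ^ 3 mod int p ^ Suc k)"
  by (simp add: numeral_3_eq_3 padic_integers_simps(2-) nat_pow_def mod_simps mult_ac del: power_Suc)
     (simp add: fun_eq_iff mult_ac)

text \<open>Hensel's lemma: iterated lifting gives a coherent sequence of approximate roots.
  Component \<open>k\<close> lives modulo p^(k + 1), so the hypothesis concerns \<open>p\<close>,
  respectively 9.\<close>

lemma padic_cube_root:
  fixes p :: nat
  assumes "prime p" "x \<in> carrier (padic_integers p)" "\<not> int p dvd t"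
    and "[t ^ 3 = x (of_bool (p = 3))] (mod int p ^ Suc (of_bool (p = 3)))"
  obtains y where "y \<in> carrier (padic_integers p)" "y [^]\<^bsub>padic_integers p\<^esub> (3::nat) = x"
proof -
  define e :: nat where "e = of_bool (p = 3)"
  \<comment> \<open>For \<open>p = 3\<close> the approximation solves the equation one power further
    than it is itself stable; the shift by \<open>e\<close> absorbs this loss.\<close>
  let ?P = "\<lambda>k t. \<not> int p dvd t \<and> [t ^ 3 = x (k + e)] (mod int p ^ Suc (k + e))"
  let ?Q = "\<lambda>k t t'. [t' = t] (mod int p ^ Suc k)"
  have "\<exists>f. \<forall>k. ?P k (f k) \<and> ?Q k (f k) (f (Suc k))"
  proof (rule dependent_nat_choice)
    show "\<exists>t. ?P 0 t"
      using assms(3,4) by (auto simp: e_def)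
  next
    fix t k assume t: "?P k t"
    have "[x (Suc k + e) = x (k + e)] (mod int p ^ Suc (k + e))"
      using assms(2) by (simp add: padic_integers_simps cong_def)
    then have "[t ^ 3 = x (Suc k + e)] (mod int p ^ Suc (k + e))"
      using t cong_sym cong_trans by blast
    then obtain t' where t': "[t' = t] (mod int p ^ (Suc (k + e) - e))"
        "[t' ^ 3 = x (Suc k + e)] (mod int p ^ Suc (Suc (k + e)))"
      using Hensel_cube_step[OF assms(1), of t "Suc (k + e)" "x (Suc k + e)"] t
      by (auto simp: e_def)
    then have "[t' = t] (mod int p ^ Suc k)"
      by (simp add: Suc_diff_le)
    moreover from this have "[t' = t] (mod int p)"
      by (rule cong_dvd_modulus) simp
    then have "\<not> int p dvd t'"
      using t cong_dvd_iff by blast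
    ultimately show "\<exists>t'. ?P (Suc k) t' \<and> ?Q k t t'"
      using t'(2) by auto
  qed
  then obtain f where f: "\<And>k. [f k ^ 3 = x (k + e)] (mod int p ^ Suc (k + e))"
      "\<And>k. [f (Suc k) = f k] (mod int p ^ Suc k)"
    by blast
  define y where "y = (\<lambda>k. f k mod int p ^ Suc k)"
  have "y \<in> carrier (padic_integers p)"
    unfolding y_def using assms(1) f(2) by (intro padic_integers_closedI) (simp_all add: prime_gt_0_nat)
  moreover have "y k ^ 3 mod int p ^ Suc k = x k" for k
  proof -
    have "[f k ^ 3 = x (k + e)] (mod int p ^ Suc k)"
      using f(1)[of k] by (rule cong_dvd_modulus) (simp add: le_imp_power_dvd del: power_Suc)
    then show ?thesis
      using padic_integers_cong[OF assms(2), of k "k + e"]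
      by (simp add: y_def cong_def power_mod del: power_Suc)
  qed
  ultimately show ?thesis
    using that[of y] by (simp add: padic_cube)
qed

lemma sum_of_cubes_padic_of_int:
  assumes "p > 1"
  shows "sum_of_powers (padic_integers p) 3 (length vs) (padic_of_int p (\<Sum>v\<leftarrow>vs. v ^ 3))"
proof -
  interpret cring "padic_integers p"
    by (rule cring_padic_integers) fact
  show ?thesis
  proof (induction vs)
    case Nil
    then show ?case
      by (simp add: sum_of_powers_0 padic_of_int_def padic_integers_simps(2-))
  next
    case (Cons v vs)
    have "padic_of_int p (\<Sum>v\<leftarrow>v # vs. v ^ 3) =
        padic_of_int p v [^]\<^bsub>padic_integers p\<^esub> (3::nat) \<oplus>\<^bsub>padic_integers p\<^esub>
        padic_of_int p (\<Sum>v\<leftarrow>vs. v ^ 3)"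
      unfolding padic_cube by (simp add: padic_of_int_def padic_integers_simps(2-) mod_simps del: power_Suc)
    moreover have "padic_of_int p v \<in> carrier (padic_integers p)"
      using assms by (simp add: padic_of_int_closed)
    ultimately show ?case
      using Cons.IH unfolding length_Cons sum_of_powers_Suc by blast
  qed
qed

text \<open>All summands but one may be ordinary integers: after subtracting their cubes exactly,
  what remains is congruent to the unit cube t^3, hence a cube by Hensel.\<close>

lemma padic_sum_of_cubesI:
  fixes p :: nat
  assumes "prime p" "x \<in> carrier (padic_integers p)"
    and local: "\<And>a. \<exists>t vs. \<not> int p dvd t \<and> length vs = h \<and>
      [t ^ 3 + (\<Sum>v\<leftarrow>vs. v ^ 3) = a] (mod int p ^ Suc (of_bool (p = 3)))"
  shows "sum_of_powers (padic_integers p) 3 (Suc h) x"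
proof -
  have p1: "p > 1"
    using assms(1) by (rule prime_gt_1_nat)
  interpret cring "padic_integers p"
    by (rule cring_padic_integers) fact
  let ?e = "of_bool (p = 3) :: nat"
  obtain t vs where t: "\<not> int p dvd t" "length vs = h"
      "[t ^ 3 + (\<Sum>v\<leftarrow>vs. v ^ 3) = x ?e] (mod int p ^ Suc ?e)"
    using local by blast
  define s where "s = (\<Sum>v\<leftarrow>vs. v ^ 3)"
  define w where "w = (\<lambda>k. (x k - s) mod int p ^ Suc k)"
  have w: "w \<in> carrier (padic_integers p)"
    unfolding w_def using assms(2) p1
    by (intro padic_integers_closedI cong_diff) (auto simp: padic_integers_simps cong_def)
  have "[t ^ 3 + s - s = x ?e - s] (mod int p ^ Suc ?e)"
    using t(3) unfolding s_def by (intro cong_diff cong_refl)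
  then have "[t ^ 3 = w ?e] (mod int p ^ Suc ?e)"
    by (simp add: w_def cong_def)
  then obtain y where y: "y \<in> carrier (padic_integers p)" "y [^]\<^bsub>padic_integers p\<^esub> (3::nat) = w"
    using padic_cube_root[OF assms(1) w t(1)] by blast
  have "x k mod int p ^ Suc k = x k" for k
    using padic_integers_cong[OF assms(2) order_refl] .
  then have "x = w \<oplus>\<^bsub>padic_integers p\<^esub> padic_of_int p s"
    by (simp add: w_def padic_of_int_def padic_integers_simps(2-) mod_simps del: power_Suc)
  then show ?thesis
    using sum_of_cubes_padic_of_int[OF p1, of vs] t(2) y unfolding sum_of_powers_Suc s_def by blast
qed

text \<open>Reduction to a single component, the source of the lower bounds for \<open>p = 3\<close>
  and \<open>p = 7\<close>.\<close>

lemma padic_sum_of_cubesD: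
  assumes "p > 1" "sum_of_powers (padic_integers p) 3 h x"
  shows "\<exists>vs. length vs = h \<and> [x k = (\<Sum>v\<leftarrow>vs. v ^ 3)] (mod int p ^ Suc k)"
proof -
  interpret cring "padic_integers p"
    by (rule cring_padic_integers) fact
  show ?thesis
    using assms(2)
  proof (induction h arbitrary: x)
    case 0
    then show ?case
      by (simp add: sum_of_powers_0 padic_integers_simps(2-))
  next
    case (Suc h)
    then obtain a y where ay: "sum_of_powers (padic_integers p) 3 h y"
        "x = a [^]\<^bsub>padic_integers p\<^esub> (3::nat) \<oplus>\<^bsub>padic_integers p\<^esub> y"
      unfolding sum_of_powers_Suc by blast
    obtain vs where vs: "length vs = h" "[y k = (\<Sum>v\<leftarrow>vs. v ^ 3)] (mod int p ^ Suc k)"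
      using Suc.IH ay(1) by blast
    have "[x k = a k ^ 3 + y k] (mod int p ^ Suc k)"
      unfolding ay(2) padic_cube by (simp add: padic_integers_simps(2-) cong_def mod_simps del: power_Suc)
    also have "[a k ^ 3 + y k = a k ^ 3 + (\<Sum>v\<leftarrow>vs. v ^ 3)] (mod int p ^ Suc k)"
      by (intro cong_add cong_refl vs(2))
    finally show ?case
      using vs(1) by (intro exI[of _ "a k # vs"]) simp
  qed
qed

text \<open>The valuation of the left side is divisible by 3, that of the right side is 1 modulo 3.
  Clearing the denominator \<open>v\<close> lets the same fact serve p-adic integers and p-adic
  numbers.\<close>

lemma padic_prime_not_quotient_of_cubes:
  fixes p :: nat
  assumes "prime p" "u \<in> carrier (padic_integers p)" "v \<in> carrier (padic_integers p)"
    and "v \<noteq> \<zero>\<^bsub>padic_integers p\<^esub>"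
  shows "u [^]\<^bsub>padic_integers p\<^esub> (3::nat) \<noteq>
    padic_of_int p p \<otimes>\<^bsub>padic_integers p\<^esub> v [^]\<^bsub>padic_integers p\<^esub> (3::nat)"
proof
  assume eq: "u [^]\<^bsub>padic_integers p\<^esub> (3::nat) =
    padic_of_int p p \<otimes>\<^bsub>padic_integers p\<^esub> v [^]\<^bsub>padic_integers p\<^esub> (3::nat)"
  have P: "prime_elem (int p)" and nu: "\<not> is_unit (int p)"
    using assms(1) by auto
  obtain i where i: "v i \<noteq> 0"
    using assms(4) by (auto simp: padic_integers_simps(2-))
  \<comment> \<open>As \<open>v i\<close> is nonzero, the valuation \<open>m\<close> of
    \<open>v\<close> is at most \<open>i\<close>; this \<open>k\<close> is large enough for
    divisibility by both p^(3m + 1) and p^(3m + 2) to be visible modulo p^(k + 1).\<close>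
  define k where "k = 3 * i + 3"
  define m where "m = multiplicity (int p) (v k)"
  have ni: "\<not> int p ^ Suc i dvd v k"
    using padic_integers_cong[OF assms(3), of i k] i by (auto simp: k_def simp del: power_Suc)
  then have v0: "v k \<noteq> 0"
    by auto
  have "m \<le> i"
    using ni multiplicity_dvd'[of "Suc i" "int p" "v k"] unfolding m_def by linarith
  have mv: "multiplicity (int p) (int p * v k ^ 3) = 3 * m + 1"
    using v0 P nu assms(1)
    by (simp add: prime_elem_multiplicity_mult_distrib prime_elem_multiplicity_power_distrib m_def
        prime_gt_0_nat multiplicity_self)
  have nz: "int p * v k ^ 3 \<noteq> 0"
    using v0 assms(1) by (simp add: prime_gt_0_nat)
  have "[u k ^ 3 = int p * v k ^ 3] (mod int p ^ Suc k)"
    using fun_cong[OF eq, of k] unfolding padic_cube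
    by (simp add: padic_of_int_def padic_integers_simps(2-) cong_def mod_simps del: power_Suc)
  then have dvd_iff: "int p ^ j dvd u k ^ 3 \<longleftrightarrow> int p ^ j dvd int p * v k ^ 3" if "j \<le> Suc k" for j
    using that by (intro cong_dvd_iff[OF cong_dvd_modulus]) (auto simp: le_imp_power_dvd simp del: power_Suc)
  have "int p ^ (3 * m + 1) dvd u k ^ 3"
    using dvd_iff[of "3 * m + 1"] \<open>m \<le> i\<close> mv multiplicity_dvd[of "int p" "int p * v k ^ 3"]
    by (simp add: k_def)
  moreover have "\<not> int p ^ Suc (3 * m + 1) dvd u k ^ 3"
    using dvd_iff[of "Suc (3 * m + 1)"] \<open>m \<le> i\<close> mv
      power_dvd_iff_le_multiplicity[of "int p * v k ^ 3" "int p" "Suc (3 * m + 1)"] nz nu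
    by (simp add: k_def del: power_Suc)
  ultimately have mu: "multiplicity (int p) (u k ^ 3) = 3 * m + 1" and "u k \<noteq> 0"
    by (auto intro: multiplicity_eqI)
  then have "3 * multiplicity (int p) (u k) = 3 * m + 1"
    using P by (simp add: prime_elem_multiplicity_power_distrib)
  then show False
    by presburger
qed


section \<open>The Waring numbers\<close>

lemma one_not_prime_dvd: "prime p \<Longrightarrow> \<not> int p dvd 1" "prime p \<Longrightarrow> \<not> int p dvd - 1"
  by (auto dest: prime_gt_1_nat simp: zdvd_not_zless)

lemma padic_prime_not_cube:
  fixes p :: nat
  assumes "prime p"
  shows "\<not> sum_of_powers (padic_integers p) 3 1 (padic_of_int p p)"
proof
  assume *: "sum_of_powers (padic_integers p) 3 1 (padic_of_int p p)"
  have p1: "p > 1"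
    using assms by (rule prime_gt_1_nat)
  interpret domain "padic_integers p"
    by (rule domain_padic_integers) fact
  have closed: "padic_of_int p p \<in> carrier (padic_integers p)"
    using p1 by (simp add: padic_of_int_closed)
  obtain u where "u \<in> carrier (padic_integers p)"
      "padic_of_int p p = u [^]\<^bsub>padic_integers p\<^esub> (3::nat)"
    using * unfolding One_nat_def sum_of_powers_Suc sum_of_powers_0 by auto
  then show False
    using padic_prime_not_quotient_of_cubes[OF assms, of u "\<one>\<^bsub>padic_integers p\<^esub>"] closed by simp
qed

lemma waring_number_padic_integers_eq_2:
  fixes p :: nat
  assumes "prime p"
    and local: "\<And>a. \<exists>t v. \<not> int p dvd t \<and> [t ^ 3 + v ^ 3 = a] (mod int p ^ Suc (of_bool (p = 3)))"
  shows "waring_number (padic_integers p) 3 = 2"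
proof -
  have p1: "p > 1"
    using assms(1) by (rule prime_gt_1_nat)
  interpret cring "padic_integers p"
    by (rule cring_padic_integers) fact
  have "waring_number (padic_integers p) 3 = enat (Suc 1)"
  proof (rule waring_number_eqI)
    fix x assume x: "x \<in> carrier (padic_integers p)"
    show "sum_of_powers (padic_integers p) 3 (Suc 1) x"
    proof (rule padic_sum_of_cubesI[OF assms(1) x])
      fix a
      obtain t v where "\<not> int p dvd t" "[t ^ 3 + v ^ 3 = a] (mod int p ^ Suc (of_bool (p = 3)))"
        using local by blast
      then show "\<exists>t vs. \<not> int p dvd t \<and> length vs = 1 \<and>
          [t ^ 3 + (\<Sum>v\<leftarrow>vs. v ^ 3) = a] (mod int p ^ Suc (of_bool (p = 3)))"
        by (intro exI[of _ t] exI[of _ "[v]"]) simp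
    qed
  qed (use p1 padic_prime_not_cube[OF assms(1)] in \<open>simp_all add: padic_of_int_closed\<close>)
  then show ?thesis
    by (simp add: numeral_eq_enat)
qed

text \<open>Cubes 0, 1, -1 suffice: each step removes the sign of \<open>s\<close>. One summand
  \<open>t\<close> must stay a unit even for \<open>s = 0\<close>, where 1 + (-1) is used; hence at
  least two summands.\<close>

lemma sum_of_cubes_small:
  fixes s :: int
  assumes "h > 0" "\<bar>s\<bar> \<le> int h + 1"
  shows "\<exists>t vs. t \<in> {1, - 1} \<and> length vs = h \<and> t ^ 3 + (\<Sum>v\<leftarrow>vs. v ^ 3) = s"
  using assms
proof (induction h arbitrary: s rule: nat_induct_non_zero)
  case 1
  then have s: "s \<in> {- 2, - 1, 0, 1, 2}"
    by auto
  have "\<exists>t vs. t \<in> {1, - 1} \<and> length vs = 1 \<and> t ^ 3 + (\<Sum>v\<leftarrow>vs. v ^ 3) = s"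
    if "t \<in> {1, - 1}" "t ^ 3 + v ^ 3 = s" for t v
    using that by (intro exI[of _ t] exI[of _ "[v]"]) simp
  from s this[of 1 1] this[of 1 0] this[of 1 "- 1"] this[of "- 1" 0] this[of "- 1" "- 1"]
  show ?case
    by (elim insertE emptyE) simp_all
next
  case (Suc h)
  have "\<bar>s - sgn s\<bar> \<le> int h + 1"
    using Suc.prems by (cases s "0 :: int" rule: linorder_cases) simp_all
  then obtain t vs where "t \<in> {1, - 1}" "length vs = h" "t ^ 3 + (\<Sum>v\<leftarrow>vs. v ^ 3) = s - sgn s"
    using Suc.IH by blast
  moreover have "sgn s ^ 3 = sgn s"
    by (simp add: sgn_if)
  ultimately show ?case
    by (intro exI[of _ t] exI[of _ "sgn s # vs"]) simp
qed

text \<open>If all cubes are 0, 1 or -1 modulo \<open>M\<close>, sums of n cubes reach exactly the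
  residues of absolute value at most n. Since M = 2h + 3, all residues need n = h + 1. The instances
  are M = 9 with h = 3 and M = 7 with h = 2.\<close>

lemma waring_number_padic_integers_maximal:
  fixes p h :: nat and M :: int
  defines "M \<equiv> int p ^ Suc (of_bool (p = 3))"
  assumes "prime p" "h > 0" "M = 2 * int h + 3"
    and cubes: "\<And>v :: int. \<exists>s. \<bar>s\<bar> \<le> 1 \<and> [v ^ 3 = s] (mod M)"
  shows "waring_number (padic_integers p) 3 = enat (Suc h)"
proof -
  have p1: "p > 1"
    using assms(2) by (rule prime_gt_1_nat)
  interpret cring "padic_integers p"
    by (rule cring_padic_integers) fact
  show ?thesis
  proof (rule waring_number_eqI)
    fix x assume x: "x \<in> carrier (padic_integers p)"
    show "sum_of_powers (padic_integers p) 3 (Suc h) x"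
    proof (rule padic_sum_of_cubesI[OF assms(2) x])
      fix a :: int
      \<comment> \<open>The balanced residue of \<open>a\<close>, between -(h + 1) and h +
        1.\<close>
      define s where "s = (a + (int h + 1)) mod M - (int h + 1)"
      have "\<bar>s\<bar> \<le> int h + 1"
        using pos_mod_sign[of M "a + (int h + 1)"] pos_mod_bound[of M "a + (int h + 1)"] assms(4)
        unfolding s_def by linarith
      then obtain t vs where t: "t \<in> {1, - 1}" "length vs = h" "t ^ 3 + (\<Sum>v\<leftarrow>vs. v ^ 3) = s"
        using sum_of_cubes_small[OF assms(3)] by blast
      have "[s = a + (int h + 1) - (int h + 1)] (mod M)"
        unfolding s_def by (intro cong_diff cong_refl) simp
      then have "[t ^ 3 + (\<Sum>v\<leftarrow>vs. v ^ 3) = a] (mod M)"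
        unfolding t(3) by simp
      moreover have "\<not> int p dvd t"
        using t(1) one_not_prime_dvd[OF assms(2)] by auto
      ultimately show "\<exists>t vs. \<not> int p dvd t \<and> length vs = h \<and>
          [t ^ 3 + (\<Sum>v\<leftarrow>vs. v ^ 3) = a] (mod int p ^ Suc (of_bool (p = 3)))"
        using t(2) unfolding M_def by blast
    qed
  next
    show "padic_of_int p (int h + 1) \<in> carrier (padic_integers p)"
      using p1 by (simp add: padic_of_int_closed)
    show "\<not> sum_of_powers (padic_integers p) 3 h (padic_of_int p (int h + 1))"
    proof
      assume "sum_of_powers (padic_integers p) 3 h (padic_of_int p (int h + 1))"
      from padic_sum_of_cubesD[OF p1 this, of "of_bool (p = 3)"] obtain vs
        where vs: "length vs = h" "[int h + 1 = (\<Sum>v\<leftarrow>vs. v ^ 3)] (mod M)"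
        unfolding padic_of_int_def M_def by (auto simp: cong_def simp del: power_Suc)
      have "\<exists>s. \<bar>s\<bar> \<le> int (length vs) \<and> [(\<Sum>v\<leftarrow>vs. v ^ 3) = s] (mod M)" for vs :: "int list"
      proof (induction vs)
        case (Cons v vs)
        then obtain s where s: "\<bar>s\<bar> \<le> int (length vs)" "[(\<Sum>v\<leftarrow>vs. v ^ 3) = s] (mod M)"
          by blast
        obtain r where r: "\<bar>r\<bar> \<le> 1" "[v ^ 3 = r] (mod M)"
          using cubes by blast
        have "[(\<Sum>v\<leftarrow>v # vs. v ^ 3) = r + s] (mod M)"
          using cong_add[OF r(2) s(2)] by simp
        moreover have "\<bar>r + s\<bar> \<le> int (length (v # vs))"
          using r(1) s(1) by simp
        ultimately show ?case by blast
      qed (auto intro: exI[of _ 0])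
      then obtain s where s: "\<bar>s\<bar> \<le> int h" "[(\<Sum>v\<leftarrow>vs. v ^ 3) = s] (mod M)"
        using vs(1) by blast
      \<comment> \<open>This difference lies between 1 and 2h + 1, too small for a multiple of
        \<open>M\<close>.\<close>
      then have "M dvd int h + 1 - s"
        using cong_trans[OF vs(2)] by (simp add: cong_iff_dvd_diff)
      then have "M \<le> int h + 1 - s"
        using s(1) by (intro zdvd_imp_le) auto
      then show False
        using s(1) assms(4) by simp
    qed
  qed (use assms(3) in simp_all)
qed

lemma waring_number_padic_integers_3: "waring_number (padic_integers 3) 3 = 4"
proof -
  have "\<exists>s. \<bar>s\<bar> \<le> 1 \<and> [v ^ 3 = s] (mod 9)" for v :: int
  proof -
    \<comment> \<open>With the balanced remainder \<open>s\<close> in v = 3q + s one has s^3 = s,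
      and the remaining terms of the cube are multiples of 9.\<close>
    define q s where "q = (v + 1) div 3" and "s = (v + 1) mod 3 - 1"
    have v: "v = 3 * q + s"
      using mult_div_mod_eq[of 3 "v + 1"] unfolding q_def s_def by linarith
    have s: "\<bar>s\<bar> \<le> 1"
      using pos_mod_sign[of 3 "v + 1"] pos_mod_bound[of 3 "v + 1"] unfolding s_def by linarith
    then have "s = - 1 \<or> s = 0 \<or> s = 1"
      by linarith
    then have "v ^ 3 - s = 9 * (3 * q ^ 3 + 3 * q\<^sup>2 * s + q * s\<^sup>2)"
      unfolding v by (elim disjE) (simp_all add: power2_eq_square power3_eq_cube algebra_simps)
    then show ?thesis
      using s by (intro exI[of _ s]) (simp add: cong_iff_dvd_diff)
  qed
  then show ?thesis
    using waring_number_padic_integers_maximal[of 3 3] by (simp add: numeral_eq_enat)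
qed

lemma waring_number_padic_integers_7: "waring_number (padic_integers 7) 3 = 3"
proof -
  have "\<exists>s. \<bar>s\<bar> \<le> 1 \<and> [v ^ 3 = s] (mod 7)" for v :: int
  proof -
    have "v mod 7 \<in> {0, 1, 2, 3, 4, 5, 6}"
      using pos_mod_sign[of 7 v] pos_mod_bound[of 7 v] by auto
    then have "(v mod 7) ^ 3 mod 7 \<in> {0 mod 7, 1 mod 7, - 1 mod 7}"
      by (elim insertE emptyE) simp_all
    then have "[v ^ 3 = 0] (mod 7) \<or> [v ^ 3 = 1] (mod 7) \<or> [v ^ 3 = - 1] (mod 7)"
      unfolding cong_def power_mod by blast
    then show ?thesis
      by (elim disjE) (rule exI, rule conjI[rotated], assumption, simp)+
  qed
  then show ?thesis
    using waring_number_padic_integers_maximal[of 7 2] by (simp add: numeral_eq_enat)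
qed

section \<open>The Waring number of the p-adic numbers\<close>

lemma (in "domain") fraction_class_cube:
  assumes "a \<in> carrier R" "b \<in> carrier R" "b \<noteq> \<zero>"
  shows "fraction_class R a b [^]\<^bsub>fraction_field R\<^esub> (3::nat) =
    fraction_class R (a [^] (3::nat)) (b [^] (3::nat))"
proof -
  interpret K: field "fraction_field R"
    by (rule field_fraction_field)
  show ?thesis
    using assms by (simp add: numeral_3_eq_3 fraction_class_simps)
qed

text \<open>The element p^3 y - 1 is congruent to (-1)^3 modulo p^3, which suffices for Hensel even
  if \<open>p = 3\<close>. The factor p^3 is itself a cube and can be divided out among the p-adic
  numbers.\<close>

lemma padic_one_plus_cube:
  fixes p :: nat
  assumes "prime p" "y \<in> carrier (padic_integers p)"
  obtains c where "c \<in> carrier (padic_integers p)"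
    "\<one>\<^bsub>padic_integers p\<^esub> \<oplus>\<^bsub>padic_integers p\<^esub> c [^]\<^bsub>padic_integers p\<^esub> (3::nat) =
     padic_of_int p p [^]\<^bsub>padic_integers p\<^esub> (3::nat) \<otimes>\<^bsub>padic_integers p\<^esub> y"
proof -
  define w where "w = (\<lambda>k. (int p ^ 3 * y k - 1) mod int p ^ Suc k)"
  have p1: "p > 1"
    using assms(1) by (rule prime_gt_1_nat)
  have w: "w \<in> carrier (padic_integers p)"
    unfolding w_def using assms(2) p1
    by (intro padic_integers_closedI cong_diff cong_mult) (auto simp: padic_integers_simps cong_def)
  define e :: nat where "e = of_bool (p = 3)"
  have "int p ^ Suc e dvd int p ^ 3"
    by (rule le_imp_power_dvd) (simp add: e_def)
  then have "[int p ^ 3 * y e - 1 = 0 - 1] (mod int p ^ Suc e)"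
    by (intro cong_diff cong_refl) (simp add: cong_0_iff del: power_Suc)
  then have "[(- 1) ^ 3 = w e] (mod int p ^ Suc e)"
    by (simp add: w_def cong_def del: power_Suc)
  then obtain c where c: "c \<in> carrier (padic_integers p)" "c [^]\<^bsub>padic_integers p\<^esub> (3::nat) = w"
    using padic_cube_root[OF assms(1) w one_not_prime_dvd(2)[OF assms(1)]] unfolding e_def by blast
  have "\<one>\<^bsub>padic_integers p\<^esub> \<oplus>\<^bsub>padic_integers p\<^esub> w =
     padic_of_int p p [^]\<^bsub>padic_integers p\<^esub> (3::nat) \<otimes>\<^bsub>padic_integers p\<^esub> y"
    unfolding padic_cube
    by (simp add: w_def padic_of_int_def padic_integers_simps(2-) mod_simps power_mod del: power_Suc)
  then show ?thesis
    using that c by simp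
qed

lemma padic_of_int_prime_nonzero:
  assumes "p > 1"
  shows "padic_of_int p p \<noteq> \<zero>\<^bsub>padic_integers p\<^esub>"
proof
  assume "padic_of_int p p = \<zero>\<^bsub>padic_integers p\<^esub>"
  from fun_cong[OF this, of 1] have "int p * int p dvd int p * 1"
    by (simp add: padic_of_int_def padic_integers_simps(2-) mod_eq_0_iff_dvd)
  then show False
    using assms by (subst (asm) dvd_mult_cancel_left) (simp add: zdvd_not_zless)
qed

lemma waring_number_padic_numbers:
  fixes p :: nat
  assumes "prime p"
  shows "waring_number (padic_numbers p) 3 = 2"
proof -
  let ?Z = "padic_integers p" and ?K = "fraction_field (padic_integers p)"
  have p1: "p > 1"
    using assms by (rule prime_gt_1_nat)
  interpret domain ?Z
    by (rule domain_padic_integers) fact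
  interpret K: field ?K
    by (rule field_fraction_field)
  define \<pi> where "\<pi> = padic_of_int p p"
  have pi: "\<pi> \<in> carrier ?Z" "\<pi> \<noteq> \<zero>\<^bsub>?Z\<^esub>"
    unfolding \<pi>_def using p1 padic_of_int_prime_nonzero by (simp_all add: padic_of_int_closed)
  have cube0: "x [^]\<^bsub>?Z\<^esub> (3::nat) \<noteq> \<zero>\<^bsub>?Z\<^esub>" if "x \<in> carrier ?Z" "x \<noteq> \<zero>\<^bsub>?Z\<^esub>" for x
    using that by (simp add: numeral_3_eq_3 integral_iff)
  have "waring_number ?K 3 = enat (Suc 1)"
  proof (rule K.waring_number_eqI)
    fix X assume "X \<in> carrier ?K"
    \<comment> \<open>Since a / b = p^3 a b^2 / (p b)^3, it is enough to write the numerator p^3 a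
      b^2 as 1 + c^3.\<close>
    then obtain a b where ab: "a \<in> carrier ?Z" "b \<in> carrier ?Z" "b \<noteq> \<zero>\<^bsub>?Z\<^esub>" "X = fraction_class ?Z a b"
      by (rule fraction_fieldE)
    obtain c where c: "c \<in> carrier ?Z"
      "\<one>\<^bsub>?Z\<^esub> \<oplus>\<^bsub>?Z\<^esub> c [^]\<^bsub>?Z\<^esub> (3::nat) = \<pi> [^]\<^bsub>?Z\<^esub> (3::nat) \<otimes>\<^bsub>?Z\<^esub> (a \<otimes>\<^bsub>?Z\<^esub> (b \<otimes>\<^bsub>?Z\<^esub> b))"
      using padic_one_plus_cube[OF assms, of "a \<otimes>\<^bsub>?Z\<^esub> (b \<otimes>\<^bsub>?Z\<^esub> b)"] ab unfolding \<pi>_def by blast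
    define d where "d = \<pi> \<otimes>\<^bsub>?Z\<^esub> b"
    define D where "D = d [^]\<^bsub>?Z\<^esub> (3::nat)"
    have d: "d \<in> carrier ?Z" "d \<noteq> \<zero>\<^bsub>?Z\<^esub>"
      using pi ab by (simp_all add: d_def integral_iff)
    have D: "D \<in> carrier ?Z" "D \<noteq> \<zero>\<^bsub>?Z\<^esub>"
      using d cube0 by (simp_all add: D_def)
    have D_eq: "D = \<pi> [^]\<^bsub>?Z\<^esub> (3::nat) \<otimes>\<^bsub>?Z\<^esub> (b \<otimes>\<^bsub>?Z\<^esub> (b \<otimes>\<^bsub>?Z\<^esub> b))"
      using pi ab by (simp add: D_def d_def numeral_3_eq_3 m_ac)
    have C: "c [^]\<^bsub>?Z\<^esub> (3::nat) \<in> carrier ?Z" "\<pi> [^]\<^bsub>?Z\<^esub> (3::nat) \<in> carrier ?Z"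
      using c pi by simp_all
    \<comment> \<open>Addition of fractions does not cancel, so the sum of 1 / D and c^3 / D is
      compared with a / b over the denominator D D.\<close>
    have "(\<one>\<^bsub>?Z\<^esub> \<otimes>\<^bsub>?Z\<^esub> D \<oplus>\<^bsub>?Z\<^esub> c [^]\<^bsub>?Z\<^esub> (3::nat) \<otimes>\<^bsub>?Z\<^esub> D) \<otimes>\<^bsub>?Z\<^esub> b =
        (\<one>\<^bsub>?Z\<^esub> \<oplus>\<^bsub>?Z\<^esub> c [^]\<^bsub>?Z\<^esub> (3::nat)) \<otimes>\<^bsub>?Z\<^esub> (D \<otimes>\<^bsub>?Z\<^esub> b)"
      using C D ab by (simp add: l_distr m_assoc)
    also have "\<dots> = a \<otimes>\<^bsub>?Z\<^esub> (D \<otimes>\<^bsub>?Z\<^esub> (\<pi> [^]\<^bsub>?Z\<^esub> (3::nat) \<otimes>\<^bsub>?Z\<^esub> (b \<otimes>\<^bsub>?Z\<^esub> (b \<otimes>\<^bsub>?Z\<^esub> b))))"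
      unfolding c(2) using C D ab by (simp add: m_ac)
    also have "\<dots> = a \<otimes>\<^bsub>?Z\<^esub> (D \<otimes>\<^bsub>?Z\<^esub> D)"
      by (simp add: D_eq[symmetric])
    finally have "X = fraction_class ?Z (\<one>\<^bsub>?Z\<^esub> \<otimes>\<^bsub>?Z\<^esub> D \<oplus>\<^bsub>?Z\<^esub> c [^]\<^bsub>?Z\<^esub> (3::nat) \<otimes>\<^bsub>?Z\<^esub> D) (D \<otimes>\<^bsub>?Z\<^esub> D)"
      unfolding ab(4) using C D ab by (subst fraction_class_eq_iff) (auto simp: integral_iff)
    also have "\<dots> = fraction_class ?Z \<one>\<^bsub>?Z\<^esub> D \<oplus>\<^bsub>?K\<^esub> fraction_class ?Z (c [^]\<^bsub>?Z\<^esub> (3::nat)) D"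
      using C D by (subst fraction_class_add) auto
    also have "\<dots> = fraction_class ?Z \<one>\<^bsub>?Z\<^esub> d [^]\<^bsub>?K\<^esub> (3::nat) \<oplus>\<^bsub>?K\<^esub>
        fraction_class ?Z c d [^]\<^bsub>?K\<^esub> (3::nat)"
      using d c by (simp add: fraction_class_cube D_def)
    finally have X: "X = fraction_class ?Z \<one>\<^bsub>?Z\<^esub> d [^]\<^bsub>?K\<^esub> (3::nat) \<oplus>\<^bsub>?K\<^esub>
        fraction_class ?Z c d [^]\<^bsub>?K\<^esub> (3::nat)" .
    have "fraction_class ?Z \<one>\<^bsub>?Z\<^esub> d \<in> carrier ?K" "fraction_class ?Z c d \<in> carrier ?K"
      using d c by (simp_all add: fraction_class_closed)
    then show "sum_of_powers ?K 3 (Suc 1) X"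
      unfolding One_nat_def K.sum_of_powers_Suc K.sum_of_powers_0
      using X by (metis K.r_zero K.nat_pow_closed)
  next
    show P: "fraction_class ?Z \<pi> \<one>\<^bsub>?Z\<^esub> \<in> carrier ?K"
      using pi by (simp add: fraction_class_closed)
    show "\<not> sum_of_powers ?K 3 1 (fraction_class ?Z \<pi> \<one>\<^bsub>?Z\<^esub>)"
    proof
      assume "sum_of_powers ?K 3 1 (fraction_class ?Z \<pi> \<one>\<^bsub>?Z\<^esub>)"
      then obtain X where X: "X \<in> carrier ?K" "fraction_class ?Z \<pi> \<one>\<^bsub>?Z\<^esub> = X [^]\<^bsub>?K\<^esub> (3::nat)"
        unfolding One_nat_def K.sum_of_powers_Suc K.sum_of_powers_0 by auto
      obtain u v where uv: "u \<in> carrier ?Z" "v \<in> carrier ?Z" "v \<noteq> \<zero>\<^bsub>?Z\<^esub>" "X = fraction_class ?Z u v"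
        using X(1) by (rule fraction_fieldE)
      have "fraction_class ?Z \<pi> \<one>\<^bsub>?Z\<^esub> = fraction_class ?Z (u [^]\<^bsub>?Z\<^esub> (3::nat)) (v [^]\<^bsub>?Z\<^esub> (3::nat))"
        using X(2) uv by (simp add: fraction_class_cube)
      then have "\<pi> \<otimes>\<^bsub>?Z\<^esub> v [^]\<^bsub>?Z\<^esub> (3::nat) = u [^]\<^bsub>?Z\<^esub> (3::nat)"
        using uv pi cube0 by (subst (asm) fraction_class_eq_iff) auto
      then show False
        using padic_prime_not_quotient_of_cubes[OF assms uv(1-3)] by (simp add: \<pi>_def)
    qed
  qed simp_all
  then show ?thesis
    by (simp add: padic_numbers_def numeral_eq_enat)
qed

theorem mainTheorem4:
  fixes p :: nat
  assumes "prime p"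
  shows "waring_number (padic_numbers p) 3 = 2 \<and>
    (p = 3 \<longrightarrow> waring_number (padic_integers p) 3 = 4) \<and>
    (p = 7 \<longrightarrow> waring_number (padic_integers p) 3 = 3) \<and>
    ([p = 1] (mod 3) \<and> p \<noteq> 7 \<longrightarrow> waring_number (padic_integers p) 3 = 2) \<and>
    ([p = 2] (mod 3) \<longrightarrow> waring_number (padic_integers p) 3 = 2)"
proof (intro conjI impI)
  assume p: "[p = 1] (mod 3) \<and> p \<noteq> 7"
  show "waring_number (padic_integers p) 3 = 2"
  proof (rule waring_number_padic_integers_eq_2[OF assms])
    fix a
    have "p \<noteq> 3"
      using p by (auto simp: cong_def)
    then show "\<exists>t v. \<not> int p dvd t \<and> [t ^ 3 + v ^ 3 = a] (mod int p ^ Suc (of_bool (p = 3)))"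
      using sum_two_cubes_mod_prime[OF assms, of a] p by simp metis
  qed
next
  assume p: "[p = 2] (mod 3)"
  show "waring_number (padic_integers p) 3 = 2"
  proof (rule waring_number_padic_integers_eq_2[OF assms])
    fix a
    have "p \<noteq> 3"
      using p by (auto simp: cong_def)
    moreover have "\<exists>t v. \<not> int p dvd t \<and> [t ^ 3 + v ^ 3 = a] (mod int p)"
    \<comment> \<open>A cube root of a multiple of \<open>p\<close> is not a unit, so this case uses
      1 and -1 instead.\<close>
    proof (cases "int p dvd a")
      case True
      then have "[1 ^ 3 + (- 1) ^ 3 = a] (mod int p)"
        by (simp add: cong_0_iff cong_sym)
      then show ?thesis
        using one_not_prime_dvd[OF assms] by blast
    next
      case False
      obtain u where u: "[u ^ 3 = a] (mod int p)"
        using cube_root_mod_prime[OF assms p] by blast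
      then have "\<not> int p dvd u"
        using False cong_dvd_iff[OF u] by (auto simp: power3_eq_cube)
      moreover have "[u ^ 3 + 0 ^ 3 = a] (mod int p)"
        using u by simp
      ultimately show ?thesis
        by blast
    qed
    ultimately show "\<exists>t v. \<not> int p dvd t \<and> [t ^ 3 + v ^ 3 = a] (mod int p ^ Suc (of_bool (p = 3)))"
      by simp
  qed
qed (simp_all add: assms waring_number_padic_numbers waring_number_padic_integers_3
    waring_number_padic_integers_7)

end
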